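(* Let $f:\mathbb{R}^d\to\mathbb{R}$ be continuous with a unique $x^*\in\mathbb{R}^d$ such that $f(x^* )=\min f=:\underline f$; assume there is $L_f>0$ with $|f(x)-f(y)|\le L_f(1+|x|+|y|)|x-y|$ for all $x,y\in\mathbb{R}^d$, and there are $c_\ell,c_u,M>0$ with $f(x)-\underline f\le c_u(|x|^2+1)$ for all $x\in\mathbb{R}^d$ and $c_\ell|x|^2\le f(x)-\underline f$ for $|x|\ge M$. Let $\lambda,\delta,s,\Delta t>0$, let $p\in\mathbb N$, $p\ge2$, and let $\rho_0,\varrho_0\in\mathcal P_p(\mathbb{R}^d)$ be arbitrary initial measures. For $\alpha>0$ let $\rho_t^\alpha$ and $\varrho_t^{\alpha,s,\Delta t}$ be the solutions (laws) of the $\delta$-CBO scheme and of the Consensus Freezing scheme, respectively, with $\rho_0^\alpha=\rho_0$ and $\varrho_0^{\alpha,s,\Delta t}=\varrho_0$. Then there exist $\alpha_0>0$ and $S>0$ such that for all $\alpha\ge\alpha_0$ the solutions satisfy $$\mathbb E_{\rho_t^\alpha}[|x|^q]\le S,\quad \mathbb E_{\varrho_t^{\alpha,s,\Delta t}}[|x|^q]\le S,\quad\forall t\ge0,\ \forall q\in\mathbb N\text{ with }q\le p,$$ and $$|X^\alpha(\rho_t^\alpha)|\le S,\quad |X^\alpha(\varrho_t^{\alpha,s,\Delta t})|\le S,\quad\forall t\ge0.$$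
   Context: For a probability measure $\rho$ on $\mathbb{R}^d$ and $\alpha>0$, the consensus point is $X^\alpha(\rho)=\frac{\int x e^{-\alpha f(x)}d\rho(x)}{\int e^{-\alpha f(x)}d\rho(x)}$. $\mathcal P_p(\mathbb{R}^d)$ denotes probability measures with finite $p$-th moment. $\delta$-CBO scheme: $dX_t=-\lambda(X_t-X^\alpha(\rho_t^\alpha))dt+\delta\,dB_t$, $\rho_t^\alpha=\mathrm{Law}(X_t)$. Consensus Freezing scheme: $dX_t=-s\lambda\big(X_t-X^\alpha(\varrho^{\alpha,s,\Delta t}_{t_i})\big)dt+\sqrt s\,\delta\,dB_t$ for $t\in[t_i,t_{i+1})$, $t_i=i\Delta t$, $\varrho^{\alpha,s,\Delta t}_t=\mathrm{Law}(X_t)$. *)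

theory Defs
  imports "HOL-Probability.Probability"
begin

definition consensus_point ::
    "real \<Rightarrow> ('a::euclidean_space \<Rightarrow> real) \<Rightarrow> 'a measure \<Rightarrow> 'a"
  where "consensus_point \<alpha> f \<rho> =
    (1 / (\<integral>x. exp (- \<alpha> * f x) \<partial>\<rho>)) *\<^sub>R (\<integral>x. exp (- \<alpha> * f x) *\<^sub>R x \<partial>\<rho>)"

text \<open>The moment \<open>E[|x|^q]\<close> is taken in \<open>ennreal\<close>, so that a finite bound on it entails
  integrability (the Bochner integral of a non-integrable function would be 0).\<close>

definition abs_moment :: "nat \<Rightarrow> 'a::euclidean_space measure \<Rightarrow> ennreal"
  where "abs_moment q \<rho> = (\<integral>\<^sup>+x. ennreal (norm x ^ q) \<partial>\<rho>)"

definition prob_measures_finite_moment :: "nat \<Rightarrow> 'a::euclidean_space measure set"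
  where "prob_measures_finite_moment p =
    {\<rho>. prob_space \<rho> \<and> sets \<rho> = sets borel \<and> abs_moment p \<rho> < \<infinity>}"

abbreviation law :: "'w measure \<Rightarrow> ('w \<Rightarrow> 'a::euclidean_space) \<Rightarrow> 'a measure"
  where "law P Z \<equiv> distr P borel Z"

text \<open>The centred Gaussian measure with covariance \<open>v\<close> times the identity, for \<open>v > 0\<close>.
  The second parameter of \<^const>\<open>normal_density\<close> is the standard deviation.\<close>

definition isotropic_gaussian :: "real \<Rightarrow> 'a::euclidean_space measure"
  where "isotropic_gaussian v =
    density lborel (\<lambda>x. ennreal (\<Prod>b\<in>Basis. normal_density 0 (sqrt v) (x \<bullet> b)))"

text \<open>Processes and filtrations are indexed by all reals; only times \<open>t \<ge> 0\<close> matter.\<close>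

definition adapted_process ::
    "(real \<Rightarrow> 'w measure) \<Rightarrow> (real \<Rightarrow> 'w \<Rightarrow> 'a::euclidean_space) \<Rightarrow> bool"
  where "adapted_process F Z \<longleftrightarrow> (\<forall>t\<ge>0. Z t \<in> borel_measurable (F t))"

definition filtered_prob_space :: "'w measure \<Rightarrow> (real \<Rightarrow> 'w measure) \<Rightarrow> bool"
  where "filtered_prob_space P F \<longleftrightarrow>
    prob_space P \<and> filtration (space P) F \<and> (\<forall>t. subalgebra P (F t))"

definition brownian_motion ::
    "'w measure \<Rightarrow> (real \<Rightarrow> 'w measure) \<Rightarrow> (real \<Rightarrow> 'w \<Rightarrow> 'a::euclidean_space) \<Rightarrow> bool"
  where "brownian_motion P F B \<longleftrightarrow>
    adapted_process F B \<and>
    (AE \<omega> in P. B 0 \<omega> = 0) \<and>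
    (AE \<omega> in P. continuous_on {0..} (\<lambda>t. B t \<omega>)) \<and>
    (\<forall>r t. 0 \<le> r \<and> r < t \<longrightarrow>
       law P (\<lambda>\<omega>. B t \<omega> - B r \<omega>) = isotropic_gaussian (t - r) \<and>
       prob_space.indep_set P (sets (F r))
         (sets (vimage_algebra (space P) (\<lambda>\<omega>. B t \<omega> - B r \<omega>) borel)))"

text \<open>Solutions of \<open>dX\<^sub>t = b t X\<^sub>t dt + \<sigma> dB\<^sub>t\<close> with initial law \<open>\<mu>\<close>. Since \<open>\<sigma>\<close> is a constant, the
  stochastic integral of \<open>\<sigma>\<close> over \<open>[0, t]\<close> is \<open>\<sigma> (B\<^sub>t - B\<^sub>0)\<close>, so the usual integral form of the
  equation needs no stochastic integration. \<open>X\<^sub>0\<close> is independent of the increments of \<open>B\<close>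
  because it is measurable with respect to \<open>F 0\<close>.\<close>

definition additive_noise_SDE_solution ::
    "'w measure \<Rightarrow> (real \<Rightarrow> 'w measure) \<Rightarrow> (real \<Rightarrow> 'w \<Rightarrow> 'a::euclidean_space) \<Rightarrow>
     (real \<Rightarrow> 'a \<Rightarrow> 'a) \<Rightarrow> real \<Rightarrow> 'a measure \<Rightarrow> (real \<Rightarrow> 'w \<Rightarrow> 'a) \<Rightarrow> bool"
  where "additive_noise_SDE_solution P F B b \<sigma> \<mu> X \<longleftrightarrow>
    filtered_prob_space P F \<and> brownian_motion P F B \<and>
    adapted_process F X \<and> law P (X 0) = \<mu> \<and>
    (AE \<omega> in P. continuous_on {0..} (\<lambda>t. X t \<omega>)) \<and>
    (AE \<omega> in P. \<forall>t\<ge>0.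
       set_integrable lborel {0..t} (\<lambda>r. b r (X r \<omega>)) \<and>
       X t \<omega> = X 0 \<omega> + (LINT r:{0..t}|lborel. b r (X r \<omega>)) + \<sigma> *\<^sub>R (B t \<omega> - B 0 \<omega>))"

definition delta_CBO_solution ::
    "'w measure \<Rightarrow> (real \<Rightarrow> 'w measure) \<Rightarrow> (real \<Rightarrow> 'w \<Rightarrow> 'a::euclidean_space) \<Rightarrow>
     ('a \<Rightarrow> real) \<Rightarrow> real \<Rightarrow> real \<Rightarrow> real \<Rightarrow> 'a measure \<Rightarrow> (real \<Rightarrow> 'w \<Rightarrow> 'a) \<Rightarrow> bool"
  where "delta_CBO_solution P F B f lam \<delta> \<alpha> \<rho>0 X \<longleftrightarrow>
    additive_noise_SDE_solution P F B
      (\<lambda>t x. - lam *\<^sub>R (x - consensus_point \<alpha> f (law P (X t)))) \<delta> \<rho>0 X"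

text \<open>The grid point \<open>t\<^sub>i = i \<Delta>t\<close> with \<open>t\<^sub>i \<le> t < t\<^sub>i\<^sub>+\<^sub>1\<close>.\<close>

definition grid_time :: "real \<Rightarrow> real \<Rightarrow> real"
  where "grid_time \<Delta>t t = of_int \<lfloor>t / \<Delta>t\<rfloor> * \<Delta>t"

lemma grid_time_eq:
  fixes i :: nat
  assumes "\<Delta>t > 0" "real i * \<Delta>t \<le> t" "t < real (Suc i) * \<Delta>t"
  shows "grid_time \<Delta>t t = real i * \<Delta>t"
proof -
  have "\<lfloor>t / \<Delta>t\<rfloor> = int i"
    using assms by (intro floor_unique) (simp_all add: field_simps)
  then show ?thesis by (simp add: grid_time_def)
qed

text \<open>The equations on the intervals \<open>[t\<^sub>i, t\<^sub>i\<^sub>+\<^sub>1)\<close> are glued into one equation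
  on \<open>[0, \<infinity>)\<close> whose drift is piecewise defined in time.\<close>

definition consensus_freezing_solution ::
    "'w measure \<Rightarrow> (real \<Rightarrow> 'w measure) \<Rightarrow> (real \<Rightarrow> 'w \<Rightarrow> 'a::euclidean_space) \<Rightarrow>
     ('a \<Rightarrow> real) \<Rightarrow> real \<Rightarrow> real \<Rightarrow> real \<Rightarrow> real \<Rightarrow> real \<Rightarrow> 'a measure \<Rightarrow> (real \<Rightarrow> 'w \<Rightarrow> 'a) \<Rightarrow> bool"
  where "consensus_freezing_solution P F B f lam \<delta> s \<Delta>t \<alpha> \<rho>0 X \<longleftrightarrow>
    additive_noise_SDE_solution P F B
      (\<lambda>t x. - (s * lam) *\<^sub>R (x - consensus_point \<alpha> f (law P (X (grid_time \<Delta>t t)))))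
      (sqrt s * \<delta>) \<rho>0 X"

end

theory Submission
  imports Defs
begin

text \<open>
  Both schemes have the form \<open>dX = - \<lambda> (X - m t) dt + \<sigma> dB\<close> with a deterministic drift \<open>m\<close>, so
  \<open>X\<^sub>t\<close> is \<open>exp (- \<lambda> t) X\<^sub>0 + c t\<close> plus an independent centred Gaussian whose variance lies between
  positive constants for \<open>t \<ge> T\<close>; here \<open>c t\<close> is an exponentially weighted average of \<open>m\<close> over
  \<open>[0, t]\<close>. As long as \<open>\<bar>c\<bar> \<le> S\<close>, the moments are bounded in terms of \<open>S\<close>, and after time \<open>T\<close> the law
  gives a fixed ball mass at least \<open>\<eta> > 0\<close>, both uniformly in \<open>\<alpha>\<close>. By the quadratic growth of \<open>f\<close>,
  the consensus point is then at most \<open>R + exp (- \<alpha>) E\<bar>X\<bar> / \<eta> \<le> R + 1\<close> for large \<open>\<alpha>\<close>, where \<open>R\<close>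
  does not depend on \<open>S\<close>. Before time \<open>T\<close> it obeys a cruder bound depending on \<open>S\<close>, which is
  harmless since \<open>T\<close> is chosen afterwards. With \<open>S > R + 1\<close> and \<open>T\<close> small, \<open>\<bar>c\<bar>\<close> can never reach \<open>S\<close>.
\<close>

subsection \<open>Isotropic Gaussian measures\<close>

text \<open>The obstacle is a loop: the consensus point drives the mean, and the mean bounds the
  moments from which the consensus point is estimated. Moments alone do not close it, since the
  estimate they give for the consensus point grows with \<open>S\<close>. The noise does: it puts
  mass near the origin whatever the initial law, so that a large \<alpha> suppresses the dependence
  on the moments. Near time 0 the noise has hardly acted, hence the separate treatment of short
  times.

  The loop is run on the average \<open>c\<close> because it is continuous in time as soon as
  \<open>m\<close> is integrable; \<open>m\<close> itself may jump at the grid points. The Gaussian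
  part of the law is never identified as a stochastic integral: paths are limits of sums of Brownian
  increments with deterministic weights, and Fatou carries upper bounds for nonnegative continuous
  functions to the limit. Lower bounds on mass are therefore phrased as upper bounds on the mass
  outside.\<close>

abbreviation gaussian_dens :: "real \<Rightarrow> 'a::euclidean_space \<Rightarrow> ennreal"
  where "gaussian_dens v x \<equiv> ennreal (\<Prod>b\<in>Basis. normal_density 0 (sqrt v) (x \<bullet> b))"

lemma sets_isotropic_gaussian [measurable_cong, simp]: "sets (isotropic_gaussian v) = sets borel"
  by (simp add: isotropic_gaussian_def)

lemma space_isotropic_gaussian [simp]: "space (isotropic_gaussian v) = UNIV"
  by (simp add: isotropic_gaussian_def)

lemma nn_integral_isotropic_gaussian:
  fixes h :: "'a::euclidean_space \<Rightarrow> ennreal"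
  assumes [measurable]: "h \<in> borel_measurable borel"
  shows "(\<integral>\<^sup>+x. h x \<partial>isotropic_gaussian v) = (\<integral>\<^sup>+x. gaussian_dens v x * h x \<partial>lborel)"
  unfolding isotropic_gaussian_def by (subst nn_integral_density) auto

lemma prob_space_isotropic_gaussian:
  assumes "v > 0"
  shows "prob_space (isotropic_gaussian v :: 'a::euclidean_space measure)"
proof
  have "emeasure (isotropic_gaussian v) (space (isotropic_gaussian v :: 'a measure))
      = (\<integral>\<^sup>+(x::'a). (\<Prod>b\<in>Basis. ennreal (normal_density 0 (sqrt v) (x \<bullet> b))) \<partial>lborel)"
    by (simp add: isotropic_gaussian_def emeasure_density prod_ennreal)
  also have "\<dots> = (\<Prod>b\<in>(Basis::'a set). \<integral>\<^sup>+x. ennreal (normal_density 0 (sqrt v) x) \<partial>lborel)"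
    by (rule nn_integral_lborel_prod) auto
  also have "\<dots> = 1"
    using assms by (subst nn_integral_eq_integral) auto
  finally show "emeasure (isotropic_gaussian v) (space (isotropic_gaussian v :: 'a measure)) = 1" .
qed

lemma nn_integral_lborel_translate:
  fixes h :: "'a::euclidean_space \<Rightarrow> ennreal"
  assumes [measurable]: "h \<in> borel_measurable borel"
  shows "(\<integral>\<^sup>+x. h (c + x) \<partial>lborel) = (\<integral>\<^sup>+x. h x \<partial>lborel)"
  by (subst (2) lborel_distr_plus[of c, symmetric]) (simp add: nn_integral_distr)

text \<open>One dimension at a time: the density of the sum factorises over \<open>Basis\<close>,
  and each factor is the convolution of two centred normal densities. Test functions
  \<open>h\<close> are the form in which expectations are later composed.\<close>

lemma isotropic_gaussian_conv:
  fixes h :: "'a::euclidean_space \<Rightarrow> ennreal"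
  assumes [measurable]: "h \<in> borel_measurable borel" and v: "v > 0" "w > 0"
  shows "(\<integral>\<^sup>+x. \<integral>\<^sup>+y. h (x + y) \<partial>isotropic_gaussian w \<partial>isotropic_gaussian v)
       = (\<integral>\<^sup>+x. h x \<partial>isotropic_gaussian (v + w))"
proof -
  have conv: "(\<integral>\<^sup>+x. gaussian_dens v x * gaussian_dens w (u - x) \<partial>lborel)
      = gaussian_dens (v + w) u" for u :: 'a
  proof -
    have "(\<integral>\<^sup>+x. gaussian_dens v x * gaussian_dens w (u - x) \<partial>lborel)
      = (\<integral>\<^sup>+x. (\<Prod>b\<in>Basis. ennreal (normal_density 0 (sqrt w) (u \<bullet> b - x \<bullet> b)
            * normal_density 0 (sqrt v) (x \<bullet> b))) \<partial>lborel)"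
      by (intro nn_integral_cong)
        (simp add: ennreal_mult[symmetric] prod_nonneg prod_ennreal prod.distrib inner_diff_left mult.commute)
    also have "\<dots> = (\<Prod>b\<in>(Basis::'a set). \<integral>\<^sup>+x. ennreal (normal_density 0 (sqrt w) (u \<bullet> b - x)
            * normal_density 0 (sqrt v) x) \<partial>lborel)"
      by (rule nn_integral_lborel_prod) auto
    also have "\<dots> = (\<Prod>b\<in>(Basis::'a set). ennreal (normal_density 0 (sqrt (v + w)) (u \<bullet> b)))"
      using fun_cong[OF conv_normal_density_zero_mean[of "sqrt w" "sqrt v"]] v
      by (simp add: add.commute)
    finally show ?thesis by (simp add: prod_ennreal)
  qed
  have inner: "(\<integral>\<^sup>+y. h (x + y) \<partial>isotropic_gaussian w)
      = (\<integral>\<^sup>+u. gaussian_dens w (u - x) * h u \<partial>lborel)" for x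
    using nn_integral_lborel_translate[of "\<lambda>u. gaussian_dens w (u - x) * h u" x]
    by (simp add: nn_integral_isotropic_gaussian)
  have "(\<integral>\<^sup>+x. \<integral>\<^sup>+y. h (x + y) \<partial>isotropic_gaussian w \<partial>isotropic_gaussian v)
      = (\<integral>\<^sup>+x. gaussian_dens v x * (\<integral>\<^sup>+u. gaussian_dens w (u - x) * h u \<partial>lborel) \<partial>lborel)"
    unfolding inner by (subst nn_integral_isotropic_gaussian) auto
  also have "\<dots> = (\<integral>\<^sup>+x. \<integral>\<^sup>+u. gaussian_dens v x * (gaussian_dens w (u - x) * h u) \<partial>lborel \<partial>lborel)"
    by (subst nn_integral_cmult) auto
  also have "\<dots> = (\<integral>\<^sup>+u. \<integral>\<^sup>+x. gaussian_dens v x * (gaussian_dens w (u - x) * h u) \<partial>lborel \<partial>lborel)"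
    by (rule lborel_pair.Fubini') simp
  also have "\<dots> = (\<integral>\<^sup>+u. (\<integral>\<^sup>+x. gaussian_dens v x * gaussian_dens w (u - x) \<partial>lborel) * h u \<partial>lborel)"
    by (subst nn_integral_multc[symmetric]) (auto simp: mult.assoc)
  also have "\<dots> = (\<integral>\<^sup>+x. h x \<partial>isotropic_gaussian (v + w))"
    unfolding conv by (simp add: nn_integral_isotropic_gaussian)
  finally show ?thesis .
qed

text \<open>The Jacobian is spread over the coordinates, one factor \<open>e\<close> for each
  one-dimensional density.\<close>

lemma isotropic_gaussian_scale:
  fixes h :: "'a::euclidean_space \<Rightarrow> ennreal"
  assumes [measurable]: "h \<in> borel_measurable borel" and v: "v > 0" "e > 0"
  shows "(\<integral>\<^sup>+x. h (e *\<^sub>R x) \<partial>isotropic_gaussian v) = (\<integral>\<^sup>+x. h x \<partial>isotropic_gaussian (e\<^sup>2 * v))"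
proof -
  have dens: "ennreal (e ^ DIM('a)) * gaussian_dens (e\<^sup>2 * v) (e *\<^sub>R x) = gaussian_dens v x" for x :: 'a
  proof -
    have *: "e * normal_density 0 (sqrt (e\<^sup>2 * v)) (e * y) = normal_density 0 (sqrt v) y" for y
    proof -
      have "sqrt (2 * pi * (e\<^sup>2 * v)) = e * sqrt (2 * pi * v)"
        using v by (simp add: real_sqrt_mult)
      moreover have "- (e * y)\<^sup>2 / (2 * (e\<^sup>2 * v)) = - y\<^sup>2 / (2 * v)"
        using v by (simp add: power_mult_distrib)
      ultimately show ?thesis using v by (simp add: normal_density_def)
    qed
    have "e ^ DIM('a) * (\<Prod>b\<in>Basis. normal_density 0 (sqrt (e\<^sup>2 * v)) ((e *\<^sub>R x) \<bullet> b))
        = (\<Prod>b\<in>Basis. e * normal_density 0 (sqrt (e\<^sup>2 * v)) (e * (x \<bullet> b)))"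
      by (simp add: prod.distrib)
    then show ?thesis
      using v by (simp only: * ennreal_mult[symmetric] prod_nonneg normal_density_nonneg zero_le_power less_imp_le)
  qed
  have "(\<integral>\<^sup>+x. h x \<partial>isotropic_gaussian (e\<^sup>2 * v))
      = (\<integral>\<^sup>+x. gaussian_dens (e\<^sup>2 * v) x * h x \<partial>density (distr lborel borel (\<lambda>x. 0 + e *\<^sub>R x)) (\<lambda>_. ennreal (\<bar>e\<bar> ^ DIM('a))))"
    using v lborel_affine[of e "0::'a"] by (simp add: nn_integral_isotropic_gaussian)
  also have "\<dots> = (\<integral>\<^sup>+x. ennreal (e ^ DIM('a)) * (gaussian_dens (e\<^sup>2 * v) (e *\<^sub>R x) * h (e *\<^sub>R x)) \<partial>lborel)"
    using v by (simp add: nn_integral_density nn_integral_distr)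
  also have "\<dots> = (\<integral>\<^sup>+x. h (e *\<^sub>R x) \<partial>isotropic_gaussian v)"
    by (subst nn_integral_isotropic_gaussian, simp) (simp only: mult.assoc[symmetric] dens)
  finally show ?thesis by simp
qed

text \<open>The power is dominated by \<open>fact p * exp (norm x)\<close>, and
  \<open>norm x\<close> by the sum of the absolute coordinates, which makes the integrand a product.
  Each coordinate then only needs an exponential moment.\<close>

lemma isotropic_gaussian_moment_le:
  assumes v: "0 < v" "v \<le> V"
  shows "(\<integral>\<^sup>+(x::'a::euclidean_space). ennreal (norm x ^ p) \<partial>isotropic_gaussian v)
      \<le> ennreal (fact p * (2 * exp (V / 2)) ^ DIM('a))"
proof -
  \<comment> \<open>Completing the square: the factor \<open>exp (c * y)\<close> with
    \<open>c\<close> equal to 1 or -1 shifts the mean to \<open>c * v\<close> at the price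
    \<open>exp (v / 2)\<close>.\<close>
  have tilt: "normal_density 0 (sqrt v) y * exp (c * y) = exp (v / 2) * normal_density (c * v) (sqrt v) y"
    if "c\<^sup>2 = 1" for c y
  proof -
    have "- y\<^sup>2 / (2 * v) + c * y = v / 2 + - (y - c * v)\<^sup>2 / (2 * v)"
      using v that by (simp add: field_simps power2_eq_square)
    then have "exp (- y\<^sup>2 / (2 * v)) * exp (c * y) = exp (v / 2) * exp (- (y - c * v)\<^sup>2 / (2 * v))"
      by (simp add: exp_add[symmetric])
    then show ?thesis using v by (simp add: normal_density_def)
  qed
  have one: "(\<integral>\<^sup>+y. ennreal (normal_density 0 (sqrt v) y * exp \<bar>y\<bar>) \<partial>lborel) \<le> ennreal (2 * exp (V / 2))"
  proof -
    have "(\<integral>\<^sup>+y. ennreal (normal_density 0 (sqrt v) y * exp \<bar>y\<bar>) \<partial>lborel)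
      \<le> (\<integral>\<^sup>+y. ennreal (exp (v / 2)) * (ennreal (normal_density v (sqrt v) y) + ennreal (normal_density (- v) (sqrt v) y)) \<partial>lborel)"
    proof (intro nn_integral_mono)
      fix y
      have "normal_density 0 (sqrt v) y * exp \<bar>y\<bar>
        \<le> normal_density 0 (sqrt v) y * exp (1 * y) + normal_density 0 (sqrt v) y * exp ((-1) * y)"
        by (cases "y \<ge> 0") auto
      also have "\<dots> = exp (v / 2) * (normal_density v (sqrt v) y + normal_density (- v) (sqrt v) y)"
        using tilt[of 1 y] tilt[of "-1" y] by (simp add: distrib_left)
      finally show "ennreal (normal_density 0 (sqrt v) y * exp \<bar>y\<bar>)
        \<le> ennreal (exp (v / 2)) * (ennreal (normal_density v (sqrt v) y) + ennreal (normal_density (- v) (sqrt v) y))"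
        by (simp add: ennreal_mult[symmetric] ennreal_plus[symmetric] del: ennreal_plus)
    qed
    also have "\<dots> = ennreal (exp (v / 2)) * (1 + 1)"
      using v by (simp add: nn_integral_cmult nn_integral_add nn_integral_eq_integral)
    also have "\<dots> = ennreal (2 * exp (v / 2))"
      by (simp add: ennreal_mult' mult.commute)
    also have "\<dots> \<le> ennreal (2 * exp (V / 2))"
      using v by (intro ennreal_leI) simp
    finally show ?thesis .
  qed
  have "(\<integral>\<^sup>+(x::'a). ennreal (norm x ^ p) \<partial>isotropic_gaussian v)
     \<le> (\<integral>\<^sup>+(x::'a). ennreal (fact p) * (\<Prod>b\<in>Basis. ennreal (normal_density 0 (sqrt v) (x \<bullet> b) * exp \<bar>x \<bullet> b\<bar>)) \<partial>lborel)"
  proof (subst nn_integral_isotropic_gaussian, simp, intro nn_integral_mono)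
    fix x :: 'a
    have "norm x ^ p \<le> fact p * exp (norm x)"
    proof -
      have "(\<Sum>n\<in>{p}. norm x ^ n /\<^sub>R fact n) \<le> exp (norm x)"
        unfolding exp_def by (intro sum_le_suminf summable_exp_generic) auto
      then show ?thesis by (simp add: field_simps)
    qed
    also have "\<dots> \<le> fact p * exp (\<Sum>b\<in>Basis. \<bar>x \<bullet> b\<bar>)"
      using norm_le_l1[of x] by simp
    also have "\<dots> = fact p * (\<Prod>b\<in>Basis. exp \<bar>x \<bullet> b\<bar>)"
      by (simp add: exp_sum)
    finally have "(\<Prod>b\<in>Basis. normal_density 0 (sqrt v) (x \<bullet> b)) * norm x ^ p
      \<le> (\<Prod>b\<in>Basis. normal_density 0 (sqrt v) (x \<bullet> b)) * (fact p * (\<Prod>b\<in>Basis. exp \<bar>x \<bullet> b\<bar>))"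
      by (intro mult_left_mono prod_nonneg) auto
    then show "gaussian_dens v x * ennreal (norm x ^ p)
      \<le> ennreal (fact p) * (\<Prod>b\<in>Basis. ennreal (normal_density 0 (sqrt v) (x \<bullet> b) * exp \<bar>x \<bullet> b\<bar>))"
      by (simp add: ennreal_mult[symmetric] prod_nonneg prod_ennreal prod.distrib ac_simps)
  qed
  also have "\<dots> = ennreal (fact p) * (\<Prod>b\<in>(Basis::'a set). (\<integral>\<^sup>+y. ennreal (normal_density 0 (sqrt v) y * exp \<bar>y\<bar>) \<partial>lborel))"
    by (subst nn_integral_cmult, simp, subst nn_integral_lborel_prod) auto
  also have "\<dots> \<le> ennreal (fact p) * (\<Prod>b\<in>(Basis::'a set). ennreal (2 * exp (V / 2)))"
    using power_mono[OF one, of "DIM('a)"] by (intro mult_left_mono) auto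
  also have "\<dots> = ennreal (fact p * (2 * exp (V / 2)) ^ DIM('a))"
    unfolding prod_constant by (subst ennreal_power, simp) (rule ennreal_mult'[symmetric], simp)
  finally show ?thesis .
qed

lemma isotropic_gaussian_ball_ge:
  assumes v: "0 < v0" "v0 \<le> V"
  obtains \<kappa> where "\<kappa> > 0"
    "\<And>v (x::'a::euclidean_space). v0 \<le> v \<Longrightarrow> v \<le> V \<Longrightarrow> norm x \<le> K \<Longrightarrow>
       ennreal \<kappa> \<le> (\<integral>\<^sup>+y. indicator (cball 0 1) (x + y) \<partial>isotropic_gaussian v)"
proof -
  \<comment> \<open>The exponent takes the smallest variance and the prefactor the largest, so
    \<open>l\<close> lies below the one-dimensional density for every \<open>v\<close> between
    \<open>v0\<close> and \<open>V\<close>. When \<open>x + y\<close> is in the unit ball, no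
    coordinate of \<open>y\<close> exceeds \<open>\<bar>K\<bar> + 1\<close> in absolute
    value.\<close>
  define l where "l = exp (- (\<bar>K\<bar> + 1)\<^sup>2 / (2 * v0)) / sqrt (2 * pi * V)"
  have "l > 0" using v by (simp add: l_def)
  define m where "m = measure lborel (cball (0::'a) 1)"
  have "m > 0" by (simp add: m_def content_cball_pos)
  show thesis
  proof (rule that[of "l ^ DIM('a) * m"])
    show "l ^ DIM('a) * m > 0" using \<open>l > 0\<close> \<open>m > 0\<close> by simp
    fix v :: real and x :: 'a
    assume vv: "v0 \<le> v" "v \<le> V" and x: "norm x \<le> K"
    have dens: "ennreal (l ^ DIM('a)) \<le> gaussian_dens v y" if "norm (x + y) \<le> 1" for y
    proof -
      have "norm y \<le> \<bar>K\<bar> + 1"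
        using that x norm_triangle_ineq4[of "x + y" x] by simp
      then have yb: "\<bar>y \<bullet> b\<bar> \<le> \<bar>K\<bar> + 1" if "b \<in> Basis" for b
        using Basis_le_norm[OF that, of y] by linarith
      have "(\<Prod>b\<in>(Basis::'a set). l) \<le> (\<Prod>b\<in>Basis. normal_density 0 (sqrt v) (y \<bullet> b))"
      proof (intro prod_mono conjI)
        fix b :: 'a assume b: "b \<in> Basis"
        have sq: "(y \<bullet> b)\<^sup>2 \<le> (\<bar>K\<bar> + 1)\<^sup>2"
          using power_mono[OF yb[OF b], of 2] by simp
        have "(y \<bullet> b)\<^sup>2 / (2 * v) \<le> (\<bar>K\<bar> + 1)\<^sup>2 / (2 * v0)"
          using vv v sq by (intro frac_le) auto
        moreover have "sqrt (2 * pi * v) \<le> sqrt (2 * pi * V)" using vv v by simp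
        ultimately show "l \<le> normal_density 0 (sqrt v) (y \<bullet> b)"
          using vv v by (simp add: normal_density_def l_def frac_le)
      qed (use \<open>l > 0\<close> in auto)
      then show ?thesis by (intro ennreal_leI) simp
    qed
    have [measurable]: "(\<lambda>y. indicator (cball (0::'a) 1) (x + y) :: ennreal) \<in> borel_measurable borel"
      by (rule measurable_compose[of "(+) x" borel borel]) (auto intro!: borel_measurable_indicator)
    have "ennreal m = (\<integral>\<^sup>+y. indicator (cball (0::'a) 1) y \<partial>lborel)"
      using emeasure_lborel_cball_finite[of "0::'a" 1] by (simp add: m_def emeasure_eq_ennreal_measure)
    also have "\<dots> = (\<integral>\<^sup>+y. indicator (cball (0::'a) 1) (x + y) \<partial>lborel)"
      by (intro nn_integral_lborel_translate[symmetric] borel_measurable_indicator) simp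
    finally have "ennreal (l ^ DIM('a) * m)
        = (\<integral>\<^sup>+y. ennreal (l ^ DIM('a)) * indicator (cball (0::'a) 1) (x + y) \<partial>lborel)"
      using \<open>l > 0\<close> by (subst nn_integral_cmult) (auto simp: ennreal_mult')
    also have "\<dots> \<le> (\<integral>\<^sup>+y. gaussian_dens v y * indicator (cball (0::'a) 1) (x + y) \<partial>lborel)"
      using dens by (intro nn_integral_mono) (auto simp: indicator_def)
    also have "\<dots> = (\<integral>\<^sup>+y. indicator (cball 0 1) (x + y) \<partial>isotropic_gaussian v)"
      by (subst nn_integral_isotropic_gaussian) auto
    finally show "ennreal (l ^ DIM('a) * m) \<le> \<dots>" .
  qed
qed

subsection \<open>Averaged drifts along a path\<close>

lemma integrable_exp_scaleR:
  fixes m :: "real \<Rightarrow> 'a::euclidean_space"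
  assumes "m absolutely_integrable_on {a..b}"
  shows "(\<lambda>r. exp (c * r) *\<^sub>R m r) absolutely_integrable_on {a..b}"
proof (rule absolutely_integrable_bounded_measurable_product[where h = "(*\<^sub>R)", OF _ _ _ _ assms])
  show "bilinear ((*\<^sub>R) :: real \<Rightarrow> 'a \<Rightarrow> 'a)"
    by (simp add: bilinear_conv_bounded_bilinear bounded_bilinear_scaleR)
  show "bounded ((\<lambda>r. exp (c * r)) ` {a..b})"
    by (intro compact_imp_bounded compact_continuous_image continuous_intros) auto
qed (auto intro!: continuous_imp_measurable_on_sets_lebesgue continuous_intros)

text \<open>Variation of constants, with the stochastic convolution approximated by left-endpoint sums:
  telescope \<open>exp (\<lambda> t) X\<^sub>t\<close> over the grid and compare each increment with the integral equation.\<close>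

lemma path_tendsto:
  fixes x b m :: "real \<Rightarrow> 'a::euclidean_space" and lam t :: real
  assumes "lam > 0" "t > 0"
    and cont: "continuous_on {0..t} x"
    and m: "m absolutely_integrable_on {0..t}"
    and eq: "\<And>s. 0 \<le> s \<Longrightarrow> s \<le> t \<Longrightarrow> x s = x 0 - lam *\<^sub>R integral {0..s} (\<lambda>r. x r - m r) + sg *\<^sub>R b s"
  shows "(\<lambda>n. exp (- lam * t) *\<^sub>R (x 0 + integral {0..t} (\<lambda>r. (lam * exp (lam * r)) *\<^sub>R m r)
      + sg *\<^sub>R (\<Sum>k<n. exp (lam * (k * (t / n))) *\<^sub>R (b (Suc k * (t / n)) - b (k * (t / n)))))) \<longlonglongrightarrow> x t"
proof -
  define J where "J = integral {0..t} (\<lambda>r. (lam * exp (lam * r)) *\<^sub>R m r)"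
  define N where "N n = (\<Sum>k<n. exp (lam * (k * (t / n))) *\<^sub>R (b (Suc k * (t / n)) - b (k * (t / n))))" for n :: nat
  define C where "C = lam * lam * exp (lam * t)"
  define I where "I = integral {0..t} (\<lambda>r. norm (x r) + norm (m r))"
  have xint: "x absolutely_integrable_on {0..t}"
    using cont by (rule absolutely_integrable_continuous_real)
  have g_abs: "(\<lambda>r. norm (x r) + norm (m r)) absolutely_integrable_on {0..t}"
    using xint m by (intro set_integral_add set_integrable_norm)
  have bs: "sg *\<^sub>R b s = x s - x 0 + lam *\<^sub>R integral {0..s} (\<lambda>r. x r - m r)" if "0 \<le> s" "s \<le> t" for s
    using eq[OF that] by (simp add: algebra_simps)
  have "(\<lambda>n. exp (lam * t) *\<^sub>R x t - x 0 - J - sg *\<^sub>R N n) \<longlonglongrightarrow> 0"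
  proof (rule LIMSEQ_I)
    fix e :: real assume "e > 0"
    \<comment> \<open>With this \<open>e'\<close> the modulus of continuity of \<open>x\<close>
      contributes \<open>e / 4\<close> over the whole interval; the mesh error
      \<open>C * I * (t / real n)\<close> takes less than \<open>e / 2\<close>.\<close>
    define e' where "e' = e / (4 * lam * exp (lam * t) * t)"
    have "e' > 0" using \<open>e > 0\<close> assms by (simp add: e'_def)
    have "uniformly_continuous_on {0..t} x"
      using cont by (intro compact_uniformly_continuous) auto
    then obtain d where d: "d > 0" "\<And>u v. u \<in> {0..t} \<Longrightarrow> v \<in> {0..t} \<Longrightarrow> dist u v < d \<Longrightarrow> dist (x u) (x v) < e'"
      unfolding uniformly_continuous_on_def using \<open>e' > 0\<close> by metis
    have I: "I \<ge> 0" unfolding I_def by (intro integral_nonneg set_lebesgue_integral_eq_integral g_abs) auto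
    have lim: "(\<lambda>n. t / real n) \<longlonglongrightarrow> 0" by (rule lim_const_over_n)
    then have "(\<lambda>n. C * I * (t / real n)) \<longlonglongrightarrow> 0" by (rule tendsto_mult_right_zero)
    with lim have "\<forall>\<^sub>F n in sequentially. t / real n < d"
        "\<forall>\<^sub>F n in sequentially. C * I * (t / real n) < e / 2"
      using order_tendstoD(2) \<open>d > 0\<close> half_gt_zero[OF \<open>e > 0\<close>] by blast+
    then have "\<forall>\<^sub>F n in sequentially. n > 0 \<and> t / real n < d \<and> C * I * (t / real n) < e / 2"
      by (intro eventually_conj eventually_gt_at_top)
    then obtain n0 where n0: "\<And>n. n \<ge> n0 \<Longrightarrow> n > 0 \<and> t / real n < d \<and> C * I * (t / real n) < e / 2"
      unfolding eventually_sequentially by blast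
    have "norm (exp (lam * t) *\<^sub>R x t - x 0 - J - sg *\<^sub>R N n) < e" if "n \<ge> n0" for n
    proof -
      have n: "n > 0" "t / real n < d" "C * I * (t / real n) < e / 2" using n0[OF that] by auto
      define h where "h = t / real n"
      have h: "h > 0" "h < d" "n * h = t" using n assms by (auto simp: h_def)
      define T where "T k = real k * h" for k
      have T0: "T 0 = 0" and Tn: "T n = t" and TS: "T (Suc k) = T k + h" for k
        using h by (auto simp: T_def algebra_simps)
      have Tle: "0 \<le> T k" "T k \<le> T (Suc k)" for k using h by (auto simp: T_def)
      have Tt: "T k \<le> t" if "k \<le> n" for k
        using that h mult_right_mono[of "real k" "real n" h] by (simp add: T_def)
      have sum_int: "integral {0..T k} g = (\<Sum>j<k. integral {T j..T (Suc j)} g)"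
        if "k \<le> n" "g integrable_on {0..t}" for k and g :: "real \<Rightarrow> 'b::euclidean_space"
        using that(1)
      proof (induction k)
        case (Suc k)
        have "g integrable_on {0..T (Suc k)}"
          using Tt[OF Suc.prems] by (intro integrable_on_subinterval[OF that(2)]) auto
        then have "integral {0..T (Suc k)} g = integral {0..T k} g + integral {T k..T (Suc k)} g"
          using Tle by (intro Henstock_Kurzweil_Integration.integral_combine[symmetric]) auto
        with Suc show ?case by simp
      qed (simp add: T0)
      have sub: "{T k..T (Suc k)} \<subseteq> {0..t}" if "k < n" for k
        using Tle(1)[of k] Tt[of "Suc k"] that by auto
      \<comment> \<open>With \<open>y\<close> the value of \<open>x\<close> at the right end and
        \<open>E\<close> the weight at the left end, the error of one cell is an integral of two
        terms: \<open>y - x r\<close> with weight \<open>lam * exp (lam * r)\<close>, small by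
        uniform continuity of \<open>x\<close>, and \<open>x r - m r\<close> with weight
        \<open>lam * (exp (lam * r) - E)\<close>, of the order of the mesh times an integrable
        function.\<close>
      have piece: "norm (exp (lam * T (Suc k)) *\<^sub>R x (T (Suc k)) - exp (lam * T k) *\<^sub>R x (T k)
            - sg *\<^sub>R exp (lam * T k) *\<^sub>R (b (T (Suc k)) - b (T k))
            - integral {T k..T (Suc k)} (\<lambda>r. (lam * exp (lam * r)) *\<^sub>R m r))
          \<le> integral {T k..T (Suc k)} (\<lambda>r. lam * exp (lam * t) * e' + C * h * (norm (x r) + norm (m r)))"
        (is "norm ?L \<le> integral ?K ?g") if "k < n" for k
      proof -
        note subk = sub[OF that]
        define y where "y = x (T (Suc k))"
        define E where "E = exp (lam * T k)"
        have xa: "x absolutely_integrable_on ?K" and ma: "m absolutely_integrable_on ?K"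
          using set_integrable_subset[OF xint _ subk] set_integrable_subset[OF m _ subk] by auto
        have ema: "(\<lambda>r. (lam * exp (lam * r)) *\<^sub>R m r) integrable_on ?K"
          using integrable_exp_scaleR[OF ma, of lam]
          by (simp only: scaleR_scaleR[symmetric] set_lebesgue_integral_eq_integral(1) integrable_cmul)
        have xmi: "(\<lambda>r. x r - m r) integrable_on {0..t}"
          using xint m by (intro integrable_diff set_lebesgue_integral_eq_integral(1))
        have xmk: "(\<lambda>r. x r - m r) integrable_on ?K"
          using xmi subk by (rule integrable_on_subinterval)
        have "integral {0..T (Suc k)} (\<lambda>r. x r - m r) = integral {0..T k} (\<lambda>r. x r - m r) + integral ?K (\<lambda>r. x r - m r)"
          using sum_int[OF _ xmi, of "Suc k"] sum_int[OF _ xmi, of k] that by simp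
        then have inc: "sg *\<^sub>R (b (T (Suc k)) - b (T k)) = y - x (T k) + lam *\<^sub>R integral ?K (\<lambda>r. x r - m r)"
          using bs[of "T (Suc k)"] bs[of "T k"] Tle Tt[of k] Tt[of "Suc k"] that
          by (simp add: y_def scaleR_diff_right scaleR_add_right)
        have dexp: "((\<lambda>r. lam * exp (lam * r)) has_integral (exp (lam * T (Suc k)) - E)) ?K"
          unfolding E_def using Tle
          by (intro fundamental_theorem_of_calculus)
            (auto intro!: derivative_eq_intros simp: has_real_derivative_iff_has_vector_derivative[symmetric])
        have "?L = (exp (lam * T (Suc k)) - E) *\<^sub>R y - (E * lam) *\<^sub>R integral ?K (\<lambda>r. x r - m r)
            - integral ?K (\<lambda>r. (lam * exp (lam * r)) *\<^sub>R m r)"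
          unfolding y_def[symmetric] E_def[symmetric] scaleR_left_commute[of sg E] inc
          by (simp add: algebra_simps)
        moreover have "((\<lambda>r. (lam * exp (lam * r)) *\<^sub>R y - (E * lam) *\<^sub>R (x r - m r) - (lam * exp (lam * r)) *\<^sub>R m r)
            has_integral ((exp (lam * T (Suc k)) - E) *\<^sub>R y - (E * lam) *\<^sub>R integral ?K (\<lambda>r. x r - m r)
            - integral ?K (\<lambda>r. (lam * exp (lam * r)) *\<^sub>R m r))) ?K"
          using xmk ema dexp
          by (intro has_integral_diff has_integral_scaleR_left has_integral_cmul integrable_integral)
        ultimately have L: "((\<lambda>r. (lam * exp (lam * r)) *\<^sub>R y - (E * lam) *\<^sub>R (x r - m r) - (lam * exp (lam * r)) *\<^sub>R m r)
            has_integral ?L) ?K" by simp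
        show ?thesis
          unfolding integral_unique[OF L, symmetric]
        proof (rule integral_norm_bound_integral)
          show "?g integrable_on ?K"
            using set_integrable_subset[OF g_abs _ subk]
            by (intro integrable_add integrable_on_mult_right set_lebesgue_integral_eq_integral(1)) auto
          fix r assume r: "r \<in> ?K"
          then have rt: "r \<in> {0..t}" using subk by auto
          have ert: "exp (lam * r) \<le> exp (lam * t)" using rt assms by simp
          have "dist y (x r) < e'"
            unfolding y_def using r subk h TS[of k] by (intro d) (auto simp: dist_real_def)
          then have 1: "norm ((lam * exp (lam * r)) *\<^sub>R (y - x r)) \<le> lam * exp (lam * t) * e'"
            using ert assms by (simp add: dist_norm mult_mono)
          have "exp (lam * r) - E \<le> C / lam * h"
          proof -
            have "exp (lam * r) - E = exp (lam * r) * (1 - exp (- (lam * (r - T k))))"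
              by (simp add: E_def algebra_simps exp_add[symmetric])
            also have "\<dots> \<le> exp (lam * t) * (lam * h)"
            proof (rule mult_mono)
              have "1 + - (lam * (r - T k)) \<le> exp (- (lam * (r - T k)))" by (rule exp_ge_add_one_self)
              moreover have "lam * (r - T k) \<le> lam * h" using r TS[of k] assms by simp
              ultimately show "1 - exp (- (lam * (r - T k))) \<le> lam * h" by linarith
              show "0 \<le> 1 - exp (- (lam * (r - T k)))" using r assms by simp
            qed (use ert in auto)
            finally show ?thesis using assms by (simp add: C_def mult_ac)
          qed
          moreover have "exp (lam * r) - E \<ge> 0" using r assms by (simp add: E_def)
          ultimately have 2: "norm ((lam * (exp (lam * r) - E)) *\<^sub>R (x r - m r)) \<le> C * h * (norm (x r) + norm (m r))"
          proof -
            assume E1: "exp (lam * r) - E \<le> C / lam * h" and E2: "exp (lam * r) - E \<ge> 0"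
            have "norm ((lam * (exp (lam * r) - E)) *\<^sub>R (x r - m r)) = lam * (exp (lam * r) - E) * norm (x r - m r)"
              using E2 assms(1) by simp
            also have "\<dots> \<le> lam * (C / lam * h) * (norm (x r) + norm (m r))"
              using E1 E2 assms(1) norm_triangle_ineq4 h by (intro mult_mono) (auto simp: C_def)
            finally show ?thesis using assms(1) by simp
          qed
          have "(lam * exp (lam * r)) *\<^sub>R y - (E * lam) *\<^sub>R (x r - m r) - (lam * exp (lam * r)) *\<^sub>R m r
             = (lam * exp (lam * r)) *\<^sub>R (y - x r) + (lam * (exp (lam * r) - E)) *\<^sub>R (x r - m r)"
            by (simp add: algebra_simps)
          then show "norm ((lam * exp (lam * r)) *\<^sub>R y - (E * lam) *\<^sub>R (x r - m r) - (lam * exp (lam * r)) *\<^sub>R m r) \<le> ?g r"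
            using order_trans[OF norm_triangle_ineq add_mono[OF 1 2]] by (simp only:)
        qed (use L in blast)
      qed
      have gi: "(\<lambda>r. C * h * (norm (x r) + norm (m r))) integrable_on {0..t}"
        using integrable_cmul[OF set_lebesgue_integral_eq_integral(1)[OF g_abs], of "C * h"] by simp
      have tele: "(\<Sum>k<n. exp (lam * T (Suc k)) *\<^sub>R x (T (Suc k)) - exp (lam * T k) *\<^sub>R x (T k)) = exp (lam * t) *\<^sub>R x t - x 0"
        using sum_lessThan_telescope[of "\<lambda>k. exp (lam * T k) *\<^sub>R x (T k)" n] by (simp add: T0 Tn)
      have mint: "(\<lambda>r. (lam * exp (lam * r)) *\<^sub>R m r) integrable_on {0..t}"
        using integrable_exp_scaleR[OF m, of lam]
        by (simp only: scaleR_scaleR[symmetric] set_lebesgue_integral_eq_integral(1) integrable_cmul)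
      have Neq: "sg *\<^sub>R N n = (\<Sum>k<n. sg *\<^sub>R exp (lam * T k) *\<^sub>R (b (T (Suc k)) - b (T k)))"
        by (simp add: N_def T_def h_def scaleR_sum_right)
      have split: "exp (lam * t) *\<^sub>R x t - x 0 - J - sg *\<^sub>R N n = (\<Sum>k<n. exp (lam * T (Suc k)) *\<^sub>R x (T (Suc k)) - exp (lam * T k) *\<^sub>R x (T k)
            - sg *\<^sub>R exp (lam * T k) *\<^sub>R (b (T (Suc k)) - b (T k))
            - integral {T k..T (Suc k)} (\<lambda>r. (lam * exp (lam * r)) *\<^sub>R m r))"
        using sum_int[OF _ mint, of n] tele Neq by (simp add: J_def Tn sum_subtractf)
      have "norm (exp (lam * t) *\<^sub>R x t - x 0 - J - sg *\<^sub>R N n) \<le> (\<Sum>k<n. integral {T k..T (Suc k)} (\<lambda>r. lam * exp (lam * t) * e' + C * h * (norm (x r) + norm (m r))))"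
        unfolding split by (rule sum_norm_le, rule piece) simp
      also have "\<dots> = integral {0..t} (\<lambda>r. lam * exp (lam * t) * e' + C * h * (norm (x r) + norm (m r)))"
        using sum_int[OF order_refl integrable_add[OF integrable_const_ivl gi]] by (simp only: Tn)
      also have "\<dots> = t * (lam * exp (lam * t) * e') + C * h * I"
        using assms(2) by (subst integral_add[OF integrable_const_ivl gi]) (simp add: I_def)
      also have "\<dots> = e / 4 + C * I * (t / n)" using assms by (simp add: e'_def h_def)
      also have "\<dots> < e" using n(3) \<open>e > 0\<close> by linarith
      finally show ?thesis .
    qed
    then show "\<exists>no. \<forall>n\<ge>no. norm (exp (lam * t) *\<^sub>R x t - x 0 - J - sg *\<^sub>R N n - 0) < e" by auto
  qed
  then have "(\<lambda>n. exp (- lam * t) *\<^sub>R (exp (lam * t) *\<^sub>R x t - (exp (lam * t) *\<^sub>R x t - x 0 - J - sg *\<^sub>R N n)))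
      \<longlonglongrightarrow> exp (- lam * t) *\<^sub>R (exp (lam * t) *\<^sub>R x t - 0)"
    by (intro tendsto_intros)
  moreover have "exp (- lam * t) *\<^sub>R (exp (lam * t) *\<^sub>R x t - 0) = x t"
    by (simp add: exp_minus)
  moreover have "exp (lam * t) *\<^sub>R x t - (exp (lam * t) *\<^sub>R x t - x 0 - J - sg *\<^sub>R N n) = x 0 + J + sg *\<^sub>R N n" for n
    by simp
  ultimately show ?thesis by (simp only: N_def J_def)
qed

text \<open>The solution of \<open>c' = lam * (m - c)\<close> with \<open>c 0 = 0\<close>: what the
  drift adds to the contracted initial value. The kernel \<open>lam * exp (- lam * (t - r))\<close>
  has mass \<open>1 - exp (- lam * t)\<close> over \<open>[0, t]\<close>.\<close>

definition drift_mean :: "real \<Rightarrow> (real \<Rightarrow> 'a::euclidean_space) \<Rightarrow> real \<Rightarrow> 'a"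
  where "drift_mean lam m t = exp (- lam * t) *\<^sub>R integral {0..t} (\<lambda>r. (lam * exp (lam * r)) *\<^sub>R m r)"

lemma drift_integrable:
  fixes m :: "real \<Rightarrow> 'a::euclidean_space"
  assumes "m absolutely_integrable_on {0..t}"
  shows "(\<lambda>r. (lam * exp (lam * r)) *\<^sub>R m r) integrable_on {0..t}"
  using integrable_cmul[OF set_lebesgue_integral_eq_integral(1)[OF integrable_exp_scaleR[OF assms, of lam]], of lam]
  by simp

text \<open>The part \<open>R\<close> is averaged with weights of total mass below 1. The excess
  \<open>A\<close> acts only before time \<open>T\<close>, and each weight is at most
  \<open>lam\<close>, so its contribution vanishes with \<open>T\<close> for fixed
  \<open>A\<close>.\<close>

lemma norm_drift_mean_le:
  fixes m :: "real \<Rightarrow> 'a::euclidean_space"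
  assumes "lam > 0" "t \<ge> 0" "T > 0" "R \<ge> 0" "A \<ge> 0"
    and m: "m absolutely_integrable_on {0..t}"
    and bd: "\<And>r. 0 \<le> r \<Longrightarrow> r \<le> t \<Longrightarrow> norm (m r) \<le> R + (if r < T then A else 0)"
  shows "norm (drift_mean lam m t) \<le> R + lam * T * A"
proof -
  define K where "K = lam * exp (lam * t) * A"
  have "K \<ge> 0" using assms by (simp add: K_def)
  have 1: "((\<lambda>r. lam * exp (lam * r) * R) has_integral (exp (lam * t) * R - exp (lam * 0) * R)) {0..t}"
    using assms by (intro fundamental_theorem_of_calculus)
      (auto intro!: derivative_eq_intros simp: has_real_derivative_iff_has_vector_derivative[symmetric])
  have "((\<lambda>r. K) has_integral (min T t * K)) {0..min T t}"
    using has_integral_const_real[of K 0 "min T t"] assms by simp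
  then have 2: "((\<lambda>r. if r \<in> {0..min T t} then K else 0) has_integral (min T t * K)) {0..t}"
    by (subst has_integral_restrict) auto
  note g = has_integral_add[OF 1 2]
  have "norm (integral {0..t} (\<lambda>r. (lam * exp (lam * r)) *\<^sub>R m r))
      \<le> integral {0..t} (\<lambda>r. lam * exp (lam * r) * R + (if r \<in> {0..min T t} then K else 0))"
  proof (rule integral_norm_bound_integral[OF drift_integrable[OF m]])
    fix r assume r: "r \<in> {0..t}"
    have "norm ((lam * exp (lam * r)) *\<^sub>R m r) \<le> lam * exp (lam * r) * (R + (if r < T then A else 0))"
      using bd[of r] r assms by simp
    also have "\<dots> \<le> lam * exp (lam * r) * R + (if r \<in> {0..min T t} then K else 0)"
      using r assms by (auto simp: K_def distrib_left mult_right_mono)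
    finally show "norm ((lam * exp (lam * r)) *\<^sub>R m r) \<le> \<dots>" .
  qed (use g in blast)
  also have "\<dots> = exp (lam * t) * R - R + min T t * K"
    using integral_unique[OF g] by simp
  also have "\<dots> \<le> exp (lam * t) * R + T * K"
    using assms(4) \<open>K \<ge> 0\<close> mult_right_mono[of "min T t" T K] by linarith
  finally have "exp (- lam * t) * norm (integral {0..t} (\<lambda>r. (lam * exp (lam * r)) *\<^sub>R m r))
      \<le> exp (- lam * t) * (exp (lam * t) * R + T * K)"
    by (intro mult_left_mono) auto
  also have "\<dots> = R + lam * T * A"
    by (simp add: K_def exp_minus field_simps)
  finally show ?thesis by (simp add: drift_mean_def)
qed

lemma continuous_on_drift_mean:
  fixes m :: "real \<Rightarrow> 'a::euclidean_space"
  assumes "m absolutely_integrable_on {0..t}"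
  shows "continuous_on {0..t} (drift_mean lam m)"
  unfolding drift_mean_def
  by (intro continuous_intros indefinite_integral_continuous_1 drift_integrable assms)

text \<open>First-exit argument. The premise \<open>bd\<close> can be used at \<open>r\<close> only
  if the average has not exceeded \<open>S\<close> up to \<open>r\<close>. The average is continuous
  and starts at 0, so it could pass \<open>S\<close> only after a first time at which it equals
  \<open>S\<close>; at that time \<open>bd\<close> applies throughout the past and gives a value
  strictly below \<open>S\<close>.\<close>

lemma drift_mean_bootstrap:
  fixes m :: "real \<Rightarrow> 'a::euclidean_space"
  assumes pos: "lam > 0" "T > 0" "R \<ge> 0" "A \<ge> 0" and S: "R + lam * T * A < S"
    and m: "\<And>t. t \<ge> 0 \<Longrightarrow> m absolutely_integrable_on {0..t}"
    and bd: "\<And>r. 0 \<le> r \<Longrightarrow> (\<And>u. 0 \<le> u \<Longrightarrow> u \<le> r \<Longrightarrow> norm (drift_mean lam m u) \<le> S) \<Longrightarrow>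
               norm (m r) \<le> R + (if r < T then A else 0)"
    and t: "t \<ge> 0"
  shows "norm (drift_mean lam m t) \<le> S"
proof (rule ccontr)
  let ?c = "\<lambda>u. norm (drift_mean lam m u)"
  assume "\<not> ?c t \<le> S"
  then have tS: "S < ?c t" by simp
  have "0 \<le> lam * T * A" using pos by simp
  then have S0: "0 < S" using S pos by linarith
  have cont: "continuous_on {0..t} ?c"
    by (intro continuous_on_norm continuous_on_drift_mean m t)
  have ivt: "\<exists>v. 0 \<le> v \<and> v \<le> u \<and> ?c v = S" if "0 \<le> u" "u \<le> t" "S < ?c u" for u
    using that S0 continuous_on_subset[OF cont, of "{0..u}"]
    by (intro IVT'[of ?c 0 S u]) (auto simp: drift_mean_def)
  \<comment> \<open>The minimum of this compact level set is the first hitting time. That the level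
    is not exceeded before it follows from the intermediate value theorem once more.\<close>
  define Z where "Z = {0..t} \<inter> ?c -` {S}"
  have "closed Z" unfolding Z_def by (intro continuous_closed_preimage cont) auto
  moreover have "bounded Z" by (rule bounded_subset[of "{0..t}"]) (auto simp: Z_def)
  ultimately have "compact Z" by (simp add: compact_eq_bounded_closed)
  moreover have "Z \<noteq> {}" using ivt[OF t order_refl tS] by (auto simp: Z_def)
  ultimately obtain t1 where t1: "t1 \<in> Z" "\<And>u. u \<in> Z \<Longrightarrow> t1 \<le> u"
    using compact_attains_inf by metis
  have below: "?c u \<le> S" if "0 \<le> u" "u \<le> t1" for u
  proof (rule ccontr)
    assume "\<not> ?c u \<le> S"
    then have "S < ?c u" by simp
    have "u \<le> t" using that t1(1) by (auto simp: Z_def)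
    obtain v where v: "0 \<le> v" "v \<le> u" "?c v = S"
      using ivt[OF \<open>0 \<le> u\<close> \<open>u \<le> t\<close> \<open>S < ?c u\<close>] by auto
    then have "t1 \<le> v" using \<open>u \<le> t\<close> by (intro t1(2)) (auto simp: Z_def)
    then have "u = v" using that v by simp
    with v(3) \<open>S < ?c u\<close> show False by simp
  qed
  have "?c t1 \<le> R + lam * T * A"
    using t1(1) pos below by (intro norm_drift_mean_le m bd) (auto simp: Z_def)
  then show False using t1(1) S by (auto simp: Z_def)
qed

subsection \<open>Consensus points\<close>

text \<open>Only the mass \<open>\<eta>\<close> of a sublevel region \<open>A\<close> is used: where the quadratic growth makes \<open>f\<close>
  larger than on \<open>A\<close> by \<open>\<kappa>\<close>, the weight is smaller by the factor \<open>exp (- \<alpha> \<kappa>)\<close>.\<close>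

lemma norm_consensus_point_le:
  fixes f :: "'a::euclidean_space \<Rightarrow> real"
  assumes \<rho>: "prob_space \<rho>" "sets \<rho> = sets borel"
    and f: "continuous_on UNIV f" "\<And>x. fmin \<le> f x"
    and growth: "\<And>x. R \<le> norm x \<Longrightarrow> c\<^sub>l * (norm x)\<^sup>2 \<le> f x - fmin" and "c\<^sub>l > 0" "R \<ge> 0"
    and int: "integrable \<rho> norm"
    and A: "A \<in> sets borel" "\<eta> \<le> measure \<rho> A" "\<eta> > 0" "\<And>x. x \<in> A \<Longrightarrow> f x - fmin \<le> \<epsilon>"
    and R: "\<epsilon> + \<kappa> \<le> c\<^sub>l * R\<^sup>2" and "\<alpha> \<ge> 0"
  shows "norm (consensus_point \<alpha> f \<rho>) \<le> R + exp (- \<alpha> * \<kappa>) * (\<integral>x. norm x \<partial>\<rho>) / \<eta>"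
proof -
  interpret prob_space \<rho> by fact
  note [measurable_cong] = \<rho>(2)
  have [measurable]: "f \<in> borel_measurable borel" using f(1) by (rule borel_measurable_continuous_onI)
  have [measurable]: "A \<in> sets \<rho>" using A \<rho> by simp
  \<comment> \<open>Subtracting \<open>fmin\<close> puts the weights in \<open>(0, 1]\<close>; the
    common factor \<open>exp (- \<alpha> * fmin)\<close> cancels in the quotient.\<close>
  define w where "w x = exp (- \<alpha> * (f x - fmin))" for x
  have [measurable]: "w \<in> borel_measurable borel" unfolding w_def by simp
  have w: "0 < w x" "w x \<le> 1" for x using f(2) \<open>\<alpha> \<ge> 0\<close> by (auto simp: w_def)
  have wi: "integrable \<rho> w"
    using w by (intro integrable_const_bound[of _ 1]) (auto simp: less_imp_le)
  have wxi: "integrable \<rho> (\<lambda>x. w x *\<^sub>R x)"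
    using w by (intro Bochner_Integration.integrable_bound[OF int]) (auto simp: less_imp_le mult_left_le_one_le)
  define Z where "Z = (\<integral>x. w x \<partial>\<rho>)"
  define E where "E = (\<integral>x. norm x \<partial>\<rho>)"
  have "E \<ge> 0" by (simp add: E_def)
  have "exp (- \<alpha> * \<epsilon>) * \<eta> \<le> (\<integral>x. exp (- \<alpha> * \<epsilon>) * indicator A x \<partial>\<rho>)"
    using A by simp
  also have "\<dots> \<le> Z" unfolding Z_def
  proof (rule integral_mono[OF _ wi])
    show "exp (- \<alpha> * \<epsilon>) * indicator A x \<le> w x" for x
      using A(4)[of x] w(1)[of x] \<open>\<alpha> \<ge> 0\<close> by (cases "x \<in> A") (auto simp: w_def mult_left_mono less_imp_le)
  qed (intro integrable_mult_right integrable_real_indicator, auto simp: emeasure_eq_measure)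
  finally have Z: "exp (- \<alpha> * \<epsilon>) * \<eta> \<le> Z" .
  then have "Z > 0" using A(3) by (smt (verit) exp_gt_zero mult_pos_pos)
  have e: "exp (- \<alpha> * f x) = exp (- \<alpha> * fmin) * w x" for x
    by (simp add: w_def exp_add[symmetric] algebra_simps)
  have cp: "consensus_point \<alpha> f \<rho> = (1 / Z) *\<^sub>R (\<integral>x. w x *\<^sub>R x \<partial>\<rho>)"
    unfolding consensus_point_def e by (simp add: Z_def flip: scaleR_scaleR) simp
  have nw: "norm (w x *\<^sub>R x) = w x * norm x" for x
    using w(1)[of x] by simp
  have "norm (\<integral>x. w x *\<^sub>R x \<partial>\<rho>) \<le> (\<integral>x. norm (w x *\<^sub>R x) \<partial>\<rho>)"
    by (rule integral_norm_bound)
  \<comment> \<open>Inside radius \<open>R\<close> the norm is at most \<open>R\<close>; outside,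
    the choice of \<open>R\<close> makes the weight at most
    \<open>exp (- \<alpha> * (\<epsilon> + \<kappa>))\<close>. Division by \<open>Z\<close>, which
    is at least \<open>exp (- \<alpha> * \<epsilon>) * \<eta>\<close>, leaves the gap
    \<open>\<kappa>\<close> in the exponent.\<close>
  also have "\<dots> \<le> (\<integral>x. R * w x + exp (- \<alpha> * (\<epsilon> + \<kappa>)) * norm x \<partial>\<rho>)"
  proof (rule integral_mono)
    fix x
    show "norm (w x *\<^sub>R x) \<le> R * w x + exp (- \<alpha> * (\<epsilon> + \<kappa>)) * norm x"
    proof (cases "norm x \<le> R")
      case True
      then have "w x * norm x \<le> R * w x" using w(1)[of x] by simp
      moreover have "0 \<le> exp (- \<alpha> * (\<epsilon> + \<kappa>)) * norm x" by simp
      ultimately show ?thesis unfolding nw by linarith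
    next
      case False
      then have "R\<^sup>2 \<le> (norm x)\<^sup>2" using \<open>R \<ge> 0\<close> by (intro power_mono) auto
      then have "c\<^sub>l * R\<^sup>2 \<le> c\<^sub>l * (norm x)\<^sup>2" using \<open>c\<^sub>l > 0\<close> by simp
      then have "\<epsilon> + \<kappa> \<le> f x - fmin" using R growth[of x] False by simp
      then have "w x \<le> exp (- \<alpha> * (\<epsilon> + \<kappa>))" using \<open>\<alpha> \<ge> 0\<close> by (simp add: w_def mult_left_mono)
      then have "w x * norm x \<le> exp (- \<alpha> * (\<epsilon> + \<kappa>)) * norm x" by (rule mult_right_mono) simp
      moreover have "0 \<le> R * w x" using \<open>R \<ge> 0\<close> w(1)[of x] by simp
      ultimately show ?thesis unfolding nw by linarith
    qed
  qed (use wi int in \<open>auto intro: integrable_norm[OF wxi] simp del: norm_scaleR\<close>)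
  also have "\<dots> = R * Z + exp (- \<alpha> * (\<epsilon> + \<kappa>)) * E"
    using wi int by (simp add: Z_def E_def)
  finally have "norm (consensus_point \<alpha> f \<rho>) \<le> (R * Z + exp (- \<alpha> * (\<epsilon> + \<kappa>)) * E) / Z"
    using \<open>Z > 0\<close> by (simp add: cp divide_right_mono)
  also have "\<dots> = R + exp (- \<alpha> * (\<epsilon> + \<kappa>)) * E / Z"
    using \<open>Z > 0\<close> by (simp add: add_divide_distrib)
  also have "\<dots> \<le> R + exp (- \<alpha> * (\<epsilon> + \<kappa>)) * E / (exp (- \<alpha> * \<epsilon>) * \<eta>)"
    using Z A(3) \<open>E \<ge> 0\<close> \<open>Z > 0\<close> by (intro add_left_mono divide_left_mono) auto
  also have "\<dots> = R + exp (- \<alpha> * \<kappa>) * E / \<eta>"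
    by (simp add: distrib_left exp_add exp_diff exp_minus field_simps)
  finally show ?thesis by (simp only: E_def)
qed

subsection \<open>Adding Brownian increments\<close>

lemma measurable_nn_integral_isotropic_gaussian [measurable]:
  fixes h :: "'a::euclidean_space \<Rightarrow> ennreal"
  assumes [measurable]: "h \<in> borel_measurable borel" and "v > 0"
  shows "(\<lambda>x. \<integral>\<^sup>+y. h (x + y) \<partial>isotropic_gaussian v) \<in> borel_measurable borel"
proof -
  interpret prob_space "isotropic_gaussian v :: 'a measure" by (rule prob_space_isotropic_gaussian) fact
  show ?thesis by measurable
qed

text \<open>The sigma-algebra generated by \<open>Z\<close> lies in \<open>G\<close>, so
  \<open>Z\<close> and \<open>W\<close> are independent and their joint law is a product; Fubini
  then puts the integral over \<open>W\<close> inside.\<close>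

lemma law_add_independent_gaussian:
  fixes Z W :: "'w \<Rightarrow> 'a::euclidean_space"
  assumes P: "prob_space P" and G: "subalgebra P G"
    and Z: "Z \<in> borel_measurable G" and W [measurable]: "W \<in> borel_measurable P"
    and ind: "prob_space.indep_set P (sets G) (sets (vimage_algebra (space P) W borel))"
    and lW: "law P W = isotropic_gaussian v" and v: "v > 0" "e > 0"
    and h [measurable]: "h \<in> borel_measurable borel"
  shows "(\<integral>\<^sup>+\<omega>. h (Z \<omega> + e *\<^sub>R W \<omega>) \<partial>P) = (\<integral>\<^sup>+\<omega>. \<integral>\<^sup>+y. h (Z \<omega> + y) \<partial>isotropic_gaussian (e\<^sup>2 * v) \<partial>P)"
proof -
  interpret P: prob_space P by fact
  interpret N: prob_space "isotropic_gaussian v :: 'a measure" by (rule prob_space_isotropic_gaussian) fact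
  have [measurable]: "Z \<in> borel_measurable P" using G Z by (rule measurable_from_subalg)
  have "P.indep_set (sigma_sets (space P) {Z -` A \<inter> space P | A. A \<in> sets borel})
      (sigma_sets (space P) {W -` A \<inter> space P | A. A \<in> sets borel})"
    unfolding P.indep_set_def
  proof (rule P.indep_sets_mono_sets[OF ind[unfolded P.indep_set_def]])
    have "space G = space P" using G by (simp add: subalgebra_def)
    then have "sigma_sets (space P) {Z -` A \<inter> space P | A. A \<in> sets borel} \<subseteq> sets G"
      using measurable_sets[OF Z] sets.sigma_sets_subset[of "{Z -` A \<inter> space P | A. A \<in> sets borel}" G]
      by auto
    moreover have "sigma_sets (space P) {W -` A \<inter> space P | A. A \<in> sets borel}
        = sets (vimage_algebra (space P) W borel)"
      by (simp add: sets_vimage_algebra)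
    ultimately show "(case i of True \<Rightarrow> sigma_sets (space P) {Z -` A \<inter> space P | A. A \<in> sets borel}
          | False \<Rightarrow> sigma_sets (space P) {W -` A \<inter> space P | A. A \<in> sets borel})
        \<subseteq> (case i of True \<Rightarrow> sets G | False \<Rightarrow> sets (vimage_algebra (space P) W borel))" for i
      by (cases i) auto
  qed
  then have "P.indep_var borel Z borel W" by (simp add: P.indep_var_eq)
  then have J: "law P Z \<Otimes>\<^sub>M law P W = distr P (borel \<Otimes>\<^sub>M borel) (\<lambda>\<omega>. (Z \<omega>, W \<omega>))"
    by (simp add: P.indep_var_distribution_eq)
  have "(\<integral>\<^sup>+\<omega>. h (Z \<omega> + e *\<^sub>R W \<omega>) \<partial>P)
      = (\<integral>\<^sup>+p. h (fst p + e *\<^sub>R snd p) \<partial>(law P Z \<Otimes>\<^sub>M law P W))"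
    unfolding J by (subst nn_integral_distr) auto
  also have "\<dots> = (\<integral>\<^sup>+z. \<integral>\<^sup>+w. h (z + e *\<^sub>R w) \<partial>isotropic_gaussian v \<partial>law P Z)"
    unfolding lW by (subst N.nn_integral_fst[symmetric]) auto
  also have "\<dots> = (\<integral>\<^sup>+z. \<integral>\<^sup>+y. h (z + y) \<partial>isotropic_gaussian (e\<^sup>2 * v) \<partial>law P Z)"
    using v by (intro nn_integral_cong isotropic_gaussian_scale) auto
  also have "\<dots> = (\<integral>\<^sup>+\<omega>. \<integral>\<^sup>+y. h (Z \<omega> + y) \<partial>isotropic_gaussian (e\<^sup>2 * v) \<partial>P)"
    using v by (subst nn_integral_distr) (auto intro!: measurable_nn_integral_isotropic_gaussian)
  finally show ?thesis .
qed

text \<open>Sums of this form are Wiener integrals of step functions, shifted by a variable known at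
  the start. They are built from left to right: \<open>Y k\<close> is known at time
  \<open>T k\<close>, the next increment is independent of that past, and the Gaussians accumulated
  so far merge by convolution. The second claim leaves out \<open>k = 0\<close>, where the variance
  is 0 and \<open>isotropic_gaussian\<close> is not the Dirac measure.\<close>

lemma brownian_sum_law:
  fixes B :: "real \<Rightarrow> 'w \<Rightarrow> 'a::euclidean_space" and T a :: "nat \<Rightarrow> real"
  assumes F: "filtered_prob_space P F" and B: "brownian_motion P F B"
    and T: "0 \<le> T 0" "\<And>k. T k < T (Suc k)" and a: "\<And>k. a k > 0"
    and Z: "Z \<in> borel_measurable (F (T 0))"
  defines "Y \<equiv> \<lambda>k \<omega>. Z \<omega> + (\<Sum>j<k. a j *\<^sub>R (B (T (Suc j)) \<omega> - B (T j) \<omega>))"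
    and "V \<equiv> \<lambda>k. \<Sum>j<k. (a j)\<^sup>2 * (T (Suc j) - T j)"
  shows "Y k \<in> borel_measurable (F (T k))"
    and "k > 0 \<Longrightarrow> h \<in> borel_measurable borel \<Longrightarrow>
      (\<integral>\<^sup>+\<omega>. h (Y k \<omega>) \<partial>P) = (\<integral>\<^sup>+\<omega>. \<integral>\<^sup>+y. h (Z \<omega> + y) \<partial>isotropic_gaussian (V k) \<partial>P)"
proof -
  have P: "prob_space P" and filt: "filtration (space P) F" and sub: "\<And>t. subalgebra P (F t)"
    using F by (auto simp: filtered_prob_space_def)
  have Tpos: "0 \<le> T k" for k
    by (induction k) (use T in \<open>auto intro: order_trans less_imp_le\<close>)
  have mono: "g \<in> borel_measurable (F r)" if "g \<in> borel_measurable (F s)" "s \<le> r" for g :: "'w \<Rightarrow> 'a" and r s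
    using that(1) filtration.sets_F_mono[OF filt that(2)] filtration.space_F[OF filt]
    by (auto simp: measurable_def)
  have Bm: "B (T k) \<in> borel_measurable (F (T k))" for k
    using B Tpos by (auto simp: brownian_motion_def adapted_process_def)
  show Ym: "Y k \<in> borel_measurable (F (T k))" for k
  proof (induction k)
    case 0
    then show ?case using Z by (simp add: Y_def)
  next
    case (Suc k)
    have [measurable]: "Y k \<in> borel_measurable (F (T (Suc k)))" "B (T k) \<in> borel_measurable (F (T (Suc k)))"
      "B (T (Suc k)) \<in> borel_measurable (F (T (Suc k)))"
      using mono[OF Suc] mono[OF Bm[of k]] Bm[of "Suc k"] T(2)[of k] by auto
    have "Y (Suc k) = (\<lambda>\<omega>. Y k \<omega> + a k *\<^sub>R (B (T (Suc k)) \<omega> - B (T k) \<omega>))"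
      by (simp add: Y_def fun_eq_iff)
    then show ?case by simp
  qed
  have Zm [measurable]: "Z \<in> borel_measurable P" using sub Z by (rule measurable_from_subalg)
  have step: "(\<integral>\<^sup>+\<omega>. h (Y (Suc k) \<omega>) \<partial>P)
      = (\<integral>\<^sup>+\<omega>. \<integral>\<^sup>+y. h (Y k \<omega> + y) \<partial>isotropic_gaussian ((a k)\<^sup>2 * (T (Suc k) - T k)) \<partial>P)"
    if h: "h \<in> borel_measurable borel" for h k
  proof -
    have [measurable]: "B (T j) \<in> borel_measurable P" for j using sub Bm by (rule measurable_from_subalg)
    have "(\<integral>\<^sup>+\<omega>. h (Y k \<omega> + a k *\<^sub>R (B (T (Suc k)) \<omega> - B (T k) \<omega>)) \<partial>P)
      = (\<integral>\<^sup>+\<omega>. \<integral>\<^sup>+y. h (Y k \<omega> + y) \<partial>isotropic_gaussian ((a k)\<^sup>2 * (T (Suc k) - T k)) \<partial>P)"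
      using B Tpos[of k] T(2)[of k] a h
      by (intro law_add_independent_gaussian[OF P sub Ym]) (auto simp: brownian_motion_def)
    then show ?thesis by (simp add: Y_def add.assoc)
  qed
  have Vpos: "V (Suc k) > 0" for k
    unfolding V_def using a T by (intro sum_pos mult_pos_pos zero_less_power) auto
  \<comment> \<open>The induction has to vary \<open>h\<close>: integrating out the last increment
    replaces it by its Gaussian average \<open>H\<close>.\<close>
  have "(\<integral>\<^sup>+\<omega>. h (Y (Suc k) \<omega>) \<partial>P) = (\<integral>\<^sup>+\<omega>. \<integral>\<^sup>+y. h (Z \<omega> + y) \<partial>isotropic_gaussian (V (Suc k)) \<partial>P)"
    if "h \<in> borel_measurable borel" for h k
    using that
  proof (induction k arbitrary: h)
    case 0
    then show ?case using step[of h 0] by (simp add: Y_def V_def)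
  next
    case (Suc k)
    note [measurable] = Suc.prems
    define w where "w = (a (Suc k))\<^sup>2 * (T (Suc (Suc k)) - T (Suc k))"
    have "w > 0" using a[of "Suc k"] T(2)[of "Suc k"] by (simp add: w_def)
    define H where "H x = (\<integral>\<^sup>+y. h (x + y) \<partial>isotropic_gaussian w)" for x
    have H: "H \<in> borel_measurable borel"
      unfolding H_def using Suc.prems \<open>w > 0\<close> by (rule measurable_nn_integral_isotropic_gaussian)
    have "(\<integral>\<^sup>+\<omega>. h (Y (Suc (Suc k)) \<omega>) \<partial>P) = (\<integral>\<^sup>+\<omega>. H (Y (Suc k) \<omega>) \<partial>P)"
      using step[OF Suc.prems, of "Suc k"] by (simp add: H_def w_def)
    also have "\<dots> = (\<integral>\<^sup>+\<omega>. \<integral>\<^sup>+y. H (Z \<omega> + y) \<partial>isotropic_gaussian (V (Suc k)) \<partial>P)"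
      by (rule Suc.IH[OF H])
    also have "\<dots> = (\<integral>\<^sup>+\<omega>. \<integral>\<^sup>+y. h (Z \<omega> + y) \<partial>isotropic_gaussian (V (Suc k) + w) \<partial>P)"
    proof (rule nn_integral_cong)
      fix \<omega>
      show "(\<integral>\<^sup>+y. H (Z \<omega> + y) \<partial>isotropic_gaussian (V (Suc k)))
          = (\<integral>\<^sup>+y. h (Z \<omega> + y) \<partial>isotropic_gaussian (V (Suc k) + w))"
        using isotropic_gaussian_conv[of "\<lambda>y. h (Z \<omega> + y)", OF _ Vpos \<open>w > 0\<close>]
        by (simp add: H_def add.assoc)
    qed
    finally show ?case by (simp add: V_def w_def)
  qed
  then show "(\<integral>\<^sup>+\<omega>. h (Y k \<omega>) \<partial>P) = (\<integral>\<^sup>+\<omega>. \<integral>\<^sup>+y. h (Z \<omega> + y) \<partial>isotropic_gaussian (V k) \<partial>P)"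
    if "k > 0" "h \<in> borel_measurable borel"
    using that by (cases k) auto
qed

text \<open>\<open>V\<close> is the left-endpoint Riemann sum of
  \<open>exp (- 2 * lam * (t - r))\<close> over \<open>[0, t]\<close>, a geometric sum. Evaluating
  it leaves the comparison of \<open>exp (2 * lam * h) - 1\<close> with \<open>2 * lam * h\<close>;
  they agree up to a factor \<open>exp (2 * lam * h)\<close>, which is at most
  \<open>exp (2 * lam)\<close> once the mesh is at most 1. Hence the condition
  \<open>t \<le> real n\<close> and the loss in the lower bound.\<close>

lemma variance_sum_bounds:
  fixes lam t :: real and n :: nat
  assumes "lam > 0" "t > 0" "n > 0"
  defines "V \<equiv> (\<Sum>k<n. (exp (- lam * t) * exp (lam * (k * (t / n))))\<^sup>2 * (t / n))"
  shows "V \<le> 1 / (2 * lam)"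
    and "t \<le> real n \<Longrightarrow> exp (- 2 * lam) * (1 - exp (- 2 * lam * t)) / (2 * lam) \<le> V"
proof -
  define h where "h = t / n"
  have h: "h > 0" "n * h = t" using assms by (auto simp: h_def)
  define q where "q k = exp (2 * lam * (k * h))" for k :: nat
  define Q where "Q = (\<Sum>k<n. q k)"
  have qS: "q (Suc k) = q k * exp (2 * lam * h)" for k
    by (simp add: q_def exp_add[symmetric] algebra_simps)
  have tele: "(\<Sum>k<n. q (Suc k) - q k) = exp (2 * lam * t) - 1"
    using sum_lessThan_telescope[of q n] h by (simp add: q_def)
  have tele2: "Q * (exp (2 * lam * h) - 1) = exp (2 * lam * t) - 1"
    unfolding tele[symmetric] Q_def by (simp add: qS sum_distrib_right right_diff_distrib sum_subtractf)
  have "Q \<ge> 0" by (auto simp: Q_def q_def intro: sum_nonneg)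
  have e: "(exp (- lam * t) * exp (lam * (k * h)))\<^sup>2 = exp (- 2 * lam * t) * q k" for k :: nat
    by (simp add: q_def power2_eq_square exp_add[symmetric])
  have V: "V = exp (- 2 * lam * t) * (Q * h)"
    unfolding V_def h_def[symmetric] e Q_def by (simp add: sum_distrib_left sum_distrib_right mult_ac)
  have E: "exp (- 2 * lam * t) * (exp (2 * lam * t) - 1) = 1 - exp (- 2 * lam * t)"
    by (simp add: algebra_simps exp_add[symmetric])
  have "2 * lam * h \<le> exp (2 * lam * h) - 1" using exp_ge_add_one_self[of "2 * lam * h"] by linarith
  then have "Q * (2 * lam * h) \<le> exp (2 * lam * t) - 1"
    unfolding tele2[symmetric] using \<open>Q \<ge> 0\<close> by (rule mult_left_mono)
  then have "exp (- 2 * lam * t) * (Q * (2 * lam * h)) \<le> 1 - exp (- 2 * lam * t)"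
    unfolding E[symmetric] by (rule mult_left_mono) simp
  also have "\<dots> \<le> 1" by simp
  finally show "V \<le> 1 / (2 * lam)" using \<open>lam > 0\<close> by (simp add: V field_simps)
  assume "t \<le> real n"
  then have "h \<le> 1" using assms by (simp add: h_def)
  have "exp (2 * lam * h) * (1 + - (2 * lam * h)) \<le> exp (2 * lam * h) * exp (- (2 * lam * h))"
    by (intro mult_left_mono exp_ge_add_one_self) auto
  also have "\<dots> = 1" by (simp add: exp_minus)
  finally have "exp (2 * lam * h) - 1 \<le> 2 * lam * h * exp (2 * lam * h)" by (simp add: algebra_simps)
  also have "\<dots> \<le> 2 * lam * h * exp (2 * lam)"
    using h \<open>h \<le> 1\<close> \<open>lam > 0\<close> by (intro mult_left_mono) auto
  finally have "exp (2 * lam * t) - 1 \<le> Q * (2 * lam * h * exp (2 * lam))"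
    unfolding tele2[symmetric] using \<open>Q \<ge> 0\<close> by (rule mult_left_mono)
  then have "1 - exp (- 2 * lam * t) \<le> exp (- 2 * lam * t) * (Q * (2 * lam * h * exp (2 * lam)))"
    unfolding E[symmetric] by (rule mult_left_mono) simp
  also have "\<dots> = V * 2 * lam * exp (2 * lam)" by (simp add: V mult_ac)
  finally show "exp (- 2 * lam) * (1 - exp (- 2 * lam * t)) / (2 * lam) \<le> V"
    using \<open>lam > 0\<close> by (simp add: exp_minus field_simps)
qed

subsection \<open>Expectations along solutions\<close>

text \<open>A single path transfers integrability to \<open>m\<close>, which is the continuous path
  plus \<open>1 / lam\<close> times the integrable drift. The Lebesgue integral of the equation is
  also turned into the gauge integral of the pathwise lemmas.\<close>

lemma sde_path:
  fixes m :: "real \<Rightarrow> 'a::euclidean_space"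
  assumes sol: "additive_noise_SDE_solution P F B (\<lambda>t x. - lam *\<^sub>R (x - m t)) sg \<mu> X" and "lam > 0"
  shows "AE \<omega> in P. continuous_on {0..} (\<lambda>t. X t \<omega>) \<and> (\<forall>t\<ge>0. m absolutely_integrable_on {0..t} \<and>
    X t \<omega> = X 0 \<omega> - lam *\<^sub>R integral {0..t} (\<lambda>r. X r \<omega> - m r) + sg *\<^sub>R (B t \<omega> - B 0 \<omega>))"
proof -
  have "AE \<omega> in P. continuous_on {0..} (\<lambda>t. X t \<omega>)"
    "AE \<omega> in P. \<forall>t\<ge>0. set_integrable lborel {0..t} (\<lambda>r. - lam *\<^sub>R (X r \<omega> - m r)) \<and>
       X t \<omega> = X 0 \<omega> + (LINT r:{0..t}|lborel. - lam *\<^sub>R (X r \<omega> - m r)) + sg *\<^sub>R (B t \<omega> - B 0 \<omega>)"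
    using sol by (auto simp: additive_noise_SDE_solution_def)
  then show ?thesis
  proof eventually_elim
    case (elim \<omega>)
    show ?case
    proof (intro conjI allI impI elim(1))
      fix t :: real assume t: "t \<ge> 0"
      let ?g = "\<lambda>r. - lam *\<^sub>R (X r \<omega> - m r)"
      have g: "set_integrable lborel {0..t} ?g" using elim(2) t by blast
      have "?g absolutely_integrable_on {0..t}"
        using g integrable_completion[OF borel_measurable_integrable[OF g[unfolded set_integrable_def]]]
        by (simp add: set_integrable_def)
      moreover have "(\<lambda>r. X r \<omega>) absolutely_integrable_on {0..t}"
        by (intro absolutely_integrable_continuous_real continuous_on_subset[OF elim(1)]) auto
      ultimately have "(\<lambda>r. X r \<omega> + (1 / lam) *\<^sub>R ?g r) absolutely_integrable_on {0..t}"
        by (intro set_integral_add set_integrable_scaleR_right[where a = "1 / lam"])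
      then show "m absolutely_integrable_on {0..t}"
        using \<open>lam > 0\<close> by simp
      have "(LINT r:{0..t}|lborel. ?g r) = integral {0..t} ?g"
        by (rule set_borel_integral_eq_integral(2)[OF g])
      also have "\<dots> = - lam *\<^sub>R integral {0..t} (\<lambda>r. X r \<omega> - m r)"
        by (rule integral_cmul)
      finally have I: "(LINT r:{0..t}|lborel. ?g r) = - lam *\<^sub>R integral {0..t} (\<lambda>r. X r \<omega> - m r)" .
      have eq: "X t \<omega> = X 0 \<omega> + (LINT r:{0..t}|lborel. ?g r) + sg *\<^sub>R (B t \<omega> - B 0 \<omega>)"
        using elim(2) t by blast
      show "X t \<omega> = X 0 \<omega> - lam *\<^sub>R integral {0..t} (\<lambda>r. X r \<omega> - m r) + sg *\<^sub>R (B t \<omega> - B 0 \<omega>)"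
        by (subst eq, subst I) simp
    qed
  qed
qed

text \<open>Integrability in time of the consensus point comes from the equation itself. The claim
  does not involve the path, so under a probability measure holding almost surely is the same as
  holding.\<close>

lemma sde_drift_integrable:
  fixes m :: "real \<Rightarrow> 'a::euclidean_space"
  assumes sol: "additive_noise_SDE_solution P F B (\<lambda>t x. - lam *\<^sub>R (x - m t)) sg \<mu> X" and "lam > 0" "t \<ge> 0"
  shows "m absolutely_integrable_on {0..t}"
proof -
  interpret prob_space P
    using sol by (simp add: additive_noise_SDE_solution_def filtered_prob_space_def)
  have "AE \<omega> in P. m absolutely_integrable_on {0..t}"
    using sde_path[OF sol \<open>lam > 0\<close>] by eventually_elim (use \<open>t \<ge> 0\<close> in auto)
  then show ?thesis by (simp add: AE_const)
qed

lemma sde_measurable: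
  assumes sol: "additive_noise_SDE_solution P F B b sg \<mu> X" and "t \<ge> 0"
  shows "X t \<in> borel_measurable (F t)" "X t \<in> borel_measurable P"
proof -
  show *: "X t \<in> borel_measurable (F t)"
    using assms by (auto simp: additive_noise_SDE_solution_def adapted_process_def)
  have "subalgebra P (F t)"
    using sol by (auto simp: additive_noise_SDE_solution_def filtered_prob_space_def)
  then show "X t \<in> borel_measurable P" using * by (rule measurable_from_subalg)
qed

text \<open>Sums \<open>Y n\<close> with explicit Gaussian parts converge almost surely to
  \<open>X t\<close>, and Fatou bounds the expectation of \<open>h\<close>. The premise
  \<open>le\<close> ranges over an interval that contains the variance of \<open>Y n\<close> for all
  large \<open>n\<close>, so the limiting variance is never computed.\<close>

lemma sde_expectation_le:
  fixes m :: "real \<Rightarrow> 'a::euclidean_space" and h :: "'a \<Rightarrow> real"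
  assumes sol: "additive_noise_SDE_solution P F B (\<lambda>t x. - lam *\<^sub>R (x - m t)) sg \<mu> X"
    and pos: "lam > 0" "sg > 0" "t > 0"
    and h: "continuous_on UNIV h"
    and le: "\<And>v. sg\<^sup>2 * (exp (- 2 * lam) * (1 - exp (- 2 * lam * t)) / (2 * lam)) \<le> v \<Longrightarrow> v \<le> sg\<^sup>2 / (2 * lam) \<Longrightarrow>
      (\<integral>\<^sup>+x. \<integral>\<^sup>+y. ennreal (h (exp (- lam * t) *\<^sub>R x + drift_mean lam m t + y)) \<partial>isotropic_gaussian v \<partial>\<mu>) \<le> b"
  shows "(\<integral>\<^sup>+x. ennreal (h x) \<partial>law P (X t)) \<le> b"
proof -
  have F: "filtered_prob_space P F" and B: "brownian_motion P F B" and mu: "law P (X 0) = \<mu>"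
    using sol by (auto simp: additive_noise_SDE_solution_def)
  have hm [measurable]: "h \<in> borel_measurable borel" using h by (rule borel_measurable_continuous_onI)
  have [measurable]: "X t \<in> borel_measurable P" "X 0 \<in> borel_measurable P"
    using sde_measurable(2)[OF sol] pos by auto
  define Z where "Z \<omega> = exp (- lam * t) *\<^sub>R X 0 \<omega> + drift_mean lam m t" for \<omega>
  have Z: "Z \<in> borel_measurable (F 0)"
    unfolding Z_def using sde_measurable(1)[OF sol, of 0] by simp
  define T where "T n k = real k * (t / real n)" for n k :: nat
  define a where "a n k = sg * (exp (- lam * t) * exp (lam * T n k))" for n k
  define Y where "Y n \<omega> = Z \<omega> + (\<Sum>k<n. a n k *\<^sub>R (B (T n (Suc k)) \<omega> - B (T n k) \<omega>))" for n \<omega>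
  define V where "V n = (\<Sum>k<n. (a n k)\<^sup>2 * (T n (Suc k) - T n k))" for n
  have TS: "T n (Suc k) - T n k = t / n" for n k by (simp add: T_def algebra_simps flip: add_divide_distrib)
  have T: "T n k < T n (Suc k)" "0 \<le> T n 0" if "n > 0" for n k
    using that pos TS[of n k] by (simp_all add: T_def divide_simps)
  have Ym: "Y n \<in> borel_measurable P"
    and Yh: "(\<integral>\<^sup>+\<omega>. ennreal (h (Y n \<omega>)) \<partial>P) = (\<integral>\<^sup>+\<omega>. \<integral>\<^sup>+y. ennreal (h (Z \<omega> + y)) \<partial>isotropic_gaussian (V n) \<partial>P)"
    if "n > 0" for n
  proof -
    have a: "a n k > 0" for k using pos by (simp add: a_def)
    have Z': "Z \<in> borel_measurable (F (T n 0))" using Z by (simp add: T_def)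
    have "Y n \<in> borel_measurable (F (T n n))"
      unfolding Y_def[abs_def] by (rule brownian_sum_law(1)[OF F B]) (use T that a Z' in auto)
    moreover have "subalgebra P (F (T n n))" using F by (auto simp: filtered_prob_space_def)
    ultimately show "Y n \<in> borel_measurable P" by (metis measurable_from_subalg)
    show "(\<integral>\<^sup>+\<omega>. ennreal (h (Y n \<omega>)) \<partial>P) = (\<integral>\<^sup>+\<omega>. \<integral>\<^sup>+y. ennreal (h (Z \<omega> + y)) \<partial>isotropic_gaussian (V n) \<partial>P)"
      unfolding Y_def V_def
      by (rule brownian_sum_law(2)[OF F B, where h = "\<lambda>x. ennreal (h x)"]) (use T that a Z' in auto)
  qed
  have V: "sg\<^sup>2 * (exp (- 2 * lam) * (1 - exp (- 2 * lam * t)) / (2 * lam)) \<le> V n" "V n \<le> sg\<^sup>2 / (2 * lam)" "V n > 0"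
    if "n > 0" "t \<le> real n" for n
  proof -
    have Vn: "V n = sg\<^sup>2 * (\<Sum>k<n. (exp (- lam * t) * exp (lam * (k * (t / n))))\<^sup>2 * (t / n))"
      unfolding V_def TS unfolding a_def T_def by (simp add: power_mult_distrib sum_distrib_left mult_ac)
    show "sg\<^sup>2 * (exp (- 2 * lam) * (1 - exp (- 2 * lam * t)) / (2 * lam)) \<le> V n"
      unfolding Vn using variance_sum_bounds(2)[OF pos(1,3) that(1,2)] by (intro mult_left_mono) auto
    have "V n \<le> sg\<^sup>2 * (1 / (2 * lam))"
      unfolding Vn using variance_sum_bounds(1)[OF pos(1,3) that(1)] by (intro mult_left_mono) auto
    then show "V n \<le> sg\<^sup>2 / (2 * lam)" by simp
    show "V n > 0" unfolding V_def TS unfolding a_def using pos that by (intro sum_pos) (auto simp: lessThan_empty_iff)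
  qed
  \<comment> \<open>Such \<open>n\<close> have mesh at most 1, as the lower variance bound
    demands.\<close>
  have ev: "\<forall>\<^sub>F n in sequentially. (\<integral>\<^sup>+\<omega>. ennreal (h (Y n \<omega>)) \<partial>P) \<le> b"
    using eventually_gt_at_top[of "0::nat"] eventually_ge_at_top[of "nat \<lceil>t\<rceil>"]
  proof eventually_elim
    case (elim n)
    then have n: "n > 0" "t \<le> real n" by linarith+
    have "(\<integral>\<^sup>+\<omega>. ennreal (h (Y n \<omega>)) \<partial>P) = (\<integral>\<^sup>+x. \<integral>\<^sup>+y. ennreal (h (exp (- lam * t) *\<^sub>R x + drift_mean lam m t + y)) \<partial>isotropic_gaussian (V n) \<partial>law P (X 0))"
      unfolding Yh[OF n(1)] Z_def
      by (subst nn_integral_distr)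
        (auto intro!: measurable_compose[OF _ measurable_nn_integral_isotropic_gaussian[OF _ V(3)[OF n]]])
    also have "\<dots> \<le> b" unfolding mu by (rule le[OF V(1,2)[OF n]])
    finally show ?case .
  qed
  \<comment> \<open>The driving path is taken to be the difference \<open>B t - B 0\<close>, as it
    appears in the integral equation; increments are unaffected.\<close>
  have conv: "AE \<omega> in P. (\<lambda>n. Y n \<omega>) \<longlonglongrightarrow> X t \<omega>"
    using sde_path[OF sol pos(1)]
  proof eventually_elim
    case (elim \<omega>)
    have "(\<lambda>n. exp (- lam * t) *\<^sub>R (X 0 \<omega> + integral {0..t} (\<lambda>r. (lam * exp (lam * r)) *\<^sub>R m r)
      + sg *\<^sub>R (\<Sum>k<n. exp (lam * (k * (t / n))) *\<^sub>R ((B (Suc k * (t / n)) \<omega> - B 0 \<omega>) - (B (k * (t / n)) \<omega> - B 0 \<omega>))))) \<longlonglongrightarrow> X t \<omega>"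
    proof (rule path_tendsto[where x = "\<lambda>t. X t \<omega>" and b = "\<lambda>t. B t \<omega> - B 0 \<omega>"])
      show "continuous_on {0..t} (\<lambda>t. X t \<omega>)"
        using elim by (elim conjE continuous_on_subset) auto
      show "m absolutely_integrable_on {0..t}" using elim pos by (meson less_imp_le)
      show "X s \<omega> = X 0 \<omega> - lam *\<^sub>R integral {0..s} (\<lambda>r. X r \<omega> - m r) + sg *\<^sub>R (B s \<omega> - B 0 \<omega>)" if "0 \<le> s" for s
        using elim that by blast
    qed (use pos in auto)
    moreover have "exp (- lam * t) *\<^sub>R (X 0 \<omega> + integral {0..t} (\<lambda>r. (lam * exp (lam * r)) *\<^sub>R m r)
      + sg *\<^sub>R (\<Sum>k<n. exp (lam * (k * (t / n))) *\<^sub>R ((B (Suc k * (t / n)) \<omega> - B 0 \<omega>) - (B (k * (t / n)) \<omega> - B 0 \<omega>)))) = Y n \<omega>" for n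
      by (simp add: Y_def Z_def a_def T_def drift_mean_def scaleR_add_right scaleR_sum_right mult_ac)
    ultimately show ?case by (simp only:)
  qed
  have cont: "isCont h x" for x using h by (simp add: continuous_on_eq_continuous_at)
  have "(\<integral>\<^sup>+x. ennreal (h x) \<partial>law P (X t)) = (\<integral>\<^sup>+\<omega>. ennreal (h (X t \<omega>)) \<partial>P)"
    by (rule nn_integral_distr) auto
  \<comment> \<open>The shift to \<open>Suc n\<close> avoids \<open>n = 0\<close>: measurability of
    \<open>Y n\<close> is established for \<open>n > 0\<close>.\<close>
  also have "\<dots> = (\<integral>\<^sup>+\<omega>. liminf (\<lambda>n. ennreal (h (Y (Suc n) \<omega>))) \<partial>P)"
  proof (rule nn_integral_cong_AE)
    show "AE \<omega> in P. ennreal (h (X t \<omega>)) = liminf (\<lambda>n. ennreal (h (Y (Suc n) \<omega>)))"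
      using conv
    proof eventually_elim
      case (elim \<omega>)
      have "(\<lambda>n. ennreal (h (Y (Suc n) \<omega>))) \<longlonglongrightarrow> ennreal (h (X t \<omega>))"
        by (intro tendsto_ennrealI isCont_tendsto_compose[OF cont] LIMSEQ_Suc elim)
      then show ?case by (simp add: lim_imp_Liminf)
    qed
  qed
  also have "\<dots> \<le> liminf (\<lambda>n. \<integral>\<^sup>+\<omega>. ennreal (h (Y (Suc n) \<omega>)) \<partial>P)"
    using Ym by (intro nn_integral_liminf) auto
  also have "\<dots> \<le> limsup (\<lambda>n. \<integral>\<^sup>+\<omega>. ennreal (h (Y (Suc n) \<omega>)) \<partial>P)"
    by (rule Liminf_le_Limsup) simp
  also have "\<dots> \<le> b"
    by (rule Limsup_bounded) (rule eventually_sequentially_Suc[THEN iffD2, OF ev])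
  finally show ?thesis .
qed

section \<open>Moments and mass near the origin, uniformly in time\<close>

lemma abs_moment_mono_le:
  fixes \<rho> :: "'a::euclidean_space measure"
  assumes "prob_space \<rho>" and [measurable_cong]: "sets \<rho> = sets borel"
    and "abs_moment p \<rho> \<le> ennreal Q" "Q \<ge> 0" "q \<le> p"
  shows "abs_moment q \<rho> \<le> ennreal (1 + Q)"
proof -
  interpret prob_space \<rho> by fact
  have "abs_moment q \<rho> \<le> (\<integral>\<^sup>+x. 1 + ennreal (norm x ^ p) \<partial>\<rho>)"
    unfolding abs_moment_def
  proof (rule nn_integral_mono)
    fix x :: 'a
    have "norm x ^ q \<le> 1 + norm x ^ p"
    proof (cases "norm x \<le> 1")
      case True
      then have "norm x ^ q \<le> 1" by (simp add: power_le_one)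
      then show ?thesis by (simp add: add_increasing2)
    next
      case False
      then have "norm x ^ q \<le> norm x ^ p" using \<open>q \<le> p\<close> by (intro power_increasing) auto
      then show ?thesis by simp
    qed
    then show "ennreal (norm x ^ q) \<le> 1 + ennreal (norm x ^ p)"
      by (metis ennreal_1 ennreal_leI ennreal_plus norm_ge_zero zero_le_one zero_le_power)
  qed
  also have "\<dots> = 1 + abs_moment p \<rho>"
    by (subst nn_integral_add) (auto simp: abs_moment_def emeasure_space_1)
  also have "\<dots> \<le> 1 + ennreal Q" by (intro add_left_mono assms)
  also have "\<dots> = ennreal (1 + Q)" using \<open>Q \<ge> 0\<close> by (simp add: ennreal_plus)
  finally show ?thesis .
qed

lemma first_moment_le:
  fixes \<rho> :: "'a::euclidean_space measure"
  assumes "prob_space \<rho>" and [measurable_cong]: "sets \<rho> = sets borel"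
    and "abs_moment p \<rho> \<le> ennreal Q" "Q \<ge> 0" "1 \<le> p"
  shows "integrable \<rho> norm" and "(\<integral>x. norm x \<partial>\<rho>) \<le> 1 + Q"
proof -
  have le: "(\<integral>\<^sup>+x. ennreal (norm x) \<partial>\<rho>) \<le> ennreal (1 + Q)"
    using abs_moment_mono_le[OF assms] by (simp add: abs_moment_def)
  then show i: "integrable \<rho> norm"
    by (intro integrableI_bounded) (auto simp: less_top[symmetric] top_unique)
  show "(\<integral>x. norm x \<partial>\<rho>) \<le> 1 + Q"
    using le \<open>Q \<ge> 0\<close> by (simp add: nn_integral_eq_integral[OF i] del: ennreal_plus)
qed

lemma half_mass_cball:
  fixes \<rho> :: "'a::euclidean_space measure"
  assumes "prob_space \<rho>" and [measurable_cong]: "sets \<rho> = sets borel"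
    and i: "integrable \<rho> norm" and le: "(\<integral>x. norm x \<partial>\<rho>) \<le> Q" and "Q > 0"
  shows "1 / 2 \<le> measure \<rho> (cball 0 (2 * Q))"
proof -
  interpret prob_space \<rho> by fact
  have sp: "space \<rho> = UNIV" using assms(2) sets_eq_imp_space_eq by fastforce
  have "measure \<rho> {x \<in> space \<rho>. 2 * Q \<le> norm x} \<le> (\<integral>x. norm x \<partial>\<rho>) / (2 * Q)"
    using i \<open>Q > 0\<close> by (intro integral_Markov_inequality_measure[where A = "{}"]) auto
  also have "\<dots> \<le> 1 / 2" using le \<open>Q > 0\<close> by (simp add: field_simps)
  finally have "1 / 2 \<le> 1 - measure \<rho> {x \<in> space \<rho>. 2 * Q \<le> norm x}" by simp
  also have "\<dots> = measure \<rho> (space \<rho> - {x \<in> space \<rho>. 2 * Q \<le> norm x})"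
    by (rule prob_compl[symmetric]) measurable
  also have "\<dots> \<le> measure \<rho> (cball 0 (2 * Q))"
    using assms(2) by (intro finite_measure_mono) (auto simp: sp)
  finally show ?thesis .
qed

text \<open>Three terms are estimated: the contracted initial value, the averaged drift, and a
  Gaussian whose variance never exceeds the stationary value \<open>sg\<^sup>2 / (2 * lam)\<close>.
  This cap makes the bound uniform in \<open>t\<close>. At time 0 there is no Gaussian part, hence
  the separate case.\<close>

lemma sde_moment_le:
  fixes m :: "real \<Rightarrow> 'a::euclidean_space"
  assumes sol: "additive_noise_SDE_solution P F B (\<lambda>t x. - lam *\<^sub>R (x - m t)) sg \<mu> X"
    and pos: "lam > 0" "sg > 0" "t \<ge> 0"
    and \<mu>: "prob_space \<mu>" "sets \<mu> = sets borel" "abs_moment p \<mu> \<le> ennreal M\<^sub>0" "M\<^sub>0 \<ge> 0"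
    and c: "norm (drift_mean lam m t) \<le> S"
  shows "abs_moment p (law P (X t))
      \<le> ennreal (3 ^ p * (M\<^sub>0 + S ^ p + fact p * (2 * exp (sg\<^sup>2 / (2 * lam) / 2)) ^ DIM('a)))"
proof -
  let ?G = "fact p * (2 * exp (sg\<^sup>2 / (2 * lam) / 2)) ^ DIM('a) :: real"
  interpret \<mu>: prob_space \<mu> by fact
  note [measurable_cong] = \<mu>(2)
  have S: "S \<ge> 0" using c norm_ge_zero order_trans by blast
  have G: "?G \<ge> 0" by simp
  show ?thesis
  proof (cases "t = 0")
    case True
    have "law P (X 0) = \<mu>" using sol by (simp add: additive_noise_SDE_solution_def)
    then have "abs_moment p (law P (X t)) \<le> ennreal M\<^sub>0" using True \<mu>(3) by simp
    also have "\<dots> \<le> ennreal (3 ^ p * (M\<^sub>0 + S ^ p + ?G))"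
    proof (rule ennreal_leI)
      have "M\<^sub>0 \<le> 1 * (M\<^sub>0 + S ^ p + ?G)" using S G by simp
      also have "\<dots> \<le> 3 ^ p * (M\<^sub>0 + S ^ p + ?G)"
        using S G \<mu>(4) by (intro mult_right_mono) auto
      finally show "M\<^sub>0 \<le> 3 ^ p * (M\<^sub>0 + S ^ p + ?G)" .
    qed
    finally show ?thesis .
  next
    case False
    then have t: "t > 0" using pos by simp
    show ?thesis
      unfolding abs_moment_def
    proof (rule sde_expectation_le[OF sol pos(1,2) t])
      show "continuous_on UNIV (\<lambda>x::'a. norm x ^ p)" by (intro continuous_intros)
      fix v assume v: "sg\<^sup>2 * (exp (- 2 * lam) * (1 - exp (- 2 * lam * t)) / (2 * lam)) \<le> v" "v \<le> sg\<^sup>2 / (2 * lam)"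
      have "0 < sg\<^sup>2 * (exp (- 2 * lam) * (1 - exp (- 2 * lam * t)) / (2 * lam))"
        using pos t by simp
      then have v0: "v > 0" using v by linarith
      interpret N: prob_space "isotropic_gaussian v :: 'a measure" by (rule prob_space_isotropic_gaussian[OF v0])
      \<comment> \<open>The sum of three terms is at most three times the largest, and the power of
        the largest is at most the sum of the powers; hence \<open>3 ^ p\<close>.\<close>
      have three: "ennreal (norm (exp (- lam * t) *\<^sub>R x + drift_mean lam m t + y) ^ p)
          \<le> ennreal (3 ^ p) * (ennreal (norm x ^ p) + ennreal (S ^ p) + ennreal (norm y ^ p))" for x y
      proof -
        define Mx where "Mx = Max {norm x, S, norm y}"
        have Mx: "norm x \<le> Mx" "S \<le> Mx" "norm y \<le> Mx" by (auto simp: Mx_def)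
        have "norm (exp (- lam * t) *\<^sub>R x) \<le> norm x"
          using pos t by (simp add: mult_left_le_one_le)
        then have "norm (exp (- lam * t) *\<^sub>R x + drift_mean lam m t + y) \<le> norm x + S + norm y"
          using c norm_triangle_le[of "exp (- lam * t) *\<^sub>R x" "drift_mean lam m t" "norm x + S"]
          by (intro norm_triangle_le) auto
        also have "\<dots> \<le> 3 * Mx" using Mx by simp
        finally have "norm (exp (- lam * t) *\<^sub>R x + drift_mean lam m t + y) ^ p \<le> 3 ^ p * Mx ^ p"
          by (metis norm_ge_zero power_mono power_mult_distrib)
        also have "Mx ^ p \<le> norm x ^ p + S ^ p + norm y ^ p"
        proof -
          have "Mx = norm x \<or> Mx = S \<or> Mx = norm y"
            using Max_in[of "{norm x, S, norm y}"] by (auto simp: Mx_def)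
          then show ?thesis using S by (auto simp: add_increasing add_increasing2)
        qed
        finally show ?thesis
          using S by (simp add: ennreal_plus[symmetric] ennreal_mult[symmetric] del: ennreal_plus)
      qed
      have Nm: "(\<integral>\<^sup>+(y::'a). ennreal (norm y ^ p) \<partial>isotropic_gaussian v) \<le> ennreal ?G"
        using isotropic_gaussian_moment_le[OF v0 v(2)] .
      have "(\<integral>\<^sup>+y. ennreal (norm (exp (- lam * t) *\<^sub>R x + drift_mean lam m t + y) ^ p) \<partial>isotropic_gaussian v)
          \<le> ennreal (3 ^ p) * (ennreal (norm x ^ p) + ennreal (S ^ p) + ennreal ?G)" for x
      proof -
        have "(\<integral>\<^sup>+y. ennreal (norm (exp (- lam * t) *\<^sub>R x + drift_mean lam m t + y) ^ p) \<partial>isotropic_gaussian v)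
          \<le> (\<integral>\<^sup>+(y::'a). ennreal (3 ^ p) * (ennreal (norm x ^ p) + ennreal (S ^ p) + ennreal (norm y ^ p)) \<partial>isotropic_gaussian v)"
          by (intro nn_integral_mono three)
        also have "\<dots> = ennreal (3 ^ p) * (ennreal (norm x ^ p) + ennreal (S ^ p) + (\<integral>\<^sup>+(y::'a). ennreal (norm y ^ p) \<partial>isotropic_gaussian v))"
          using N.emeasure_space_1 by (subst nn_integral_cmult, simp, subst nn_integral_add) auto
        also have "\<dots> \<le> ennreal (3 ^ p) * (ennreal (norm x ^ p) + ennreal (S ^ p) + ennreal ?G)"
          by (intro mult_left_mono add_left_mono Nm) simp
        finally show ?thesis .
      qed
      then have "(\<integral>\<^sup>+x. \<integral>\<^sup>+y. ennreal (norm (exp (- lam * t) *\<^sub>R x + drift_mean lam m t + y) ^ p) \<partial>isotropic_gaussian v \<partial>\<mu>)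
        \<le> (\<integral>\<^sup>+x. ennreal (3 ^ p) * (ennreal (norm x ^ p) + (ennreal (S ^ p) + ennreal ?G)) \<partial>\<mu>)"
        by (intro nn_integral_mono) (simp only: add.assoc)
      also have "\<dots> = ennreal (3 ^ p) * (abs_moment p \<mu> + (ennreal (S ^ p) + ennreal ?G))"
        unfolding abs_moment_def using \<mu>.emeasure_space_1
        by (subst nn_integral_cmult, simp, subst nn_integral_add) auto
      also have "\<dots> \<le> ennreal (3 ^ p) * (ennreal M\<^sub>0 + (ennreal (S ^ p) + ennreal ?G))"
        by (intro mult_left_mono add_right_mono \<mu>) simp
      also have "\<dots> = ennreal (3 ^ p * (M\<^sub>0 + S ^ p + ?G))"
        using S G \<mu>(4) by (simp only: ennreal_plus[symmetric] ennreal_mult[symmetric] zero_le_power add_nonneg_nonneg add.assoc zero_le_numeral)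
      finally show "(\<integral>\<^sup>+x. \<integral>\<^sup>+y. ennreal (norm (exp (- lam * t) *\<^sub>R x + drift_mean lam m t + y) ^ p) \<partial>isotropic_gaussian v \<partial>\<mu>)
        \<le> ennreal (3 ^ p * (M\<^sub>0 + S ^ p + ?G))" .
    qed
  qed
qed

text \<open>This is where \<open>\<delta> > 0\<close> enters: \<open>\<eta>\<close> depends neither on \<open>\<alpha>\<close> nor on the drift except through \<open>S\<close>.\<close>

lemma sde_ball_mass:
  fixes \<mu> :: "'a::euclidean_space measure"
  assumes pos: "lam > 0" "sg > 0" "T > 0"
    and \<mu>: "prob_space \<mu>" "sets \<mu> = sets borel" "1 / 2 \<le> measure \<mu> (cball 0 K)"
  obtains \<eta> where "\<eta> > 0"
    "\<And>P F B m X t. additive_noise_SDE_solution (P :: 'w measure) F B (\<lambda>t x. - lam *\<^sub>R (x - m t)) sg \<mu> X \<Longrightarrow>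
       t \<ge> T \<Longrightarrow> norm (drift_mean lam m t) \<le> S \<Longrightarrow> \<eta> \<le> measure (law P (X t)) (cball 0 2)"
proof -
  interpret \<mu>: prob_space \<mu> by fact
  note [measurable_cong] = \<mu>(2)
  \<comment> \<open>The lower variance bound at time \<open>T\<close>; it increases with time, so
    \<open>v0\<close> serves all \<open>t \<ge> T\<close>.\<close>
  define v0 where "v0 = sg\<^sup>2 * (exp (- 2 * lam) * (1 - exp (- 2 * lam * T)) / (2 * lam))"
  have v0: "v0 > 0" using pos by (simp add: v0_def)
  have "exp (- 2 * lam) * (1 - exp (- 2 * lam * T)) \<le> 1"
    using pos by (intro mult_le_one) auto
  then have "exp (- 2 * lam) * (1 - exp (- 2 * lam * T)) / (2 * lam) \<le> 1 / (2 * lam)"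
    using pos by (intro divide_right_mono) auto
  then have "v0 \<le> sg\<^sup>2 * (1 / (2 * lam))" unfolding v0_def by (rule mult_left_mono) simp
  then have v0V: "v0 \<le> sg\<^sup>2 / (2 * lam)" by simp
  obtain \<kappa> where \<kappa>: "\<kappa> > 0" "\<And>v (x::'a). v0 \<le> v \<Longrightarrow> v \<le> sg\<^sup>2 / (2 * lam) \<Longrightarrow> norm x \<le> K + S \<Longrightarrow>
       ennreal \<kappa> \<le> (\<integral>\<^sup>+y. indicator (cball 0 1) (x + y) \<partial>isotropic_gaussian v)"
    using isotropic_gaussian_ball_ge[OF v0 v0V] by metis
  \<comment> \<open>A continuous stand-in for the indicator of the complement: 0 on the unit ball, 1
    off the ball of radius 2. An upper bound for its expectation gives the lower bound for the mass
    of \<open>cball 0 2\<close>.\<close>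
  define h where "h x = min 1 (max 0 (norm x - 1))" for x :: 'a
  show thesis
  proof (rule that)
    \<comment> \<open>The 2 reflects the mass \<open>1 / 2\<close> of \<open>cball 0 K\<close> under
      \<open>\<mu>\<close>. The minimum with 1 covers the case that
      \<open>1 - ennreal (\<kappa> / 2)\<close> is truncated at 0.\<close>
    show "min 1 (\<kappa> / 2) > 0" using \<kappa> by simp
    fix P :: "'w measure" and F B m X t
    assume sol: "additive_noise_SDE_solution P F B (\<lambda>t x. - lam *\<^sub>R (x - m t)) sg \<mu> X"
      and t: "t \<ge> T" and c: "norm (drift_mean lam m t) \<le> S"
    have [measurable]: "X t \<in> borel_measurable P" using sde_measurable(2)[OF sol] t pos by auto
    interpret P: prob_space P
      using sol by (simp add: additive_noise_SDE_solution_def filtered_prob_space_def)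
    interpret L: prob_space "law P (X t)" by (rule P.prob_space_distr) simp
    have "(\<integral>\<^sup>+x. ennreal (h x) \<partial>law P (X t)) \<le> 1 - ennreal (\<kappa> / 2)"
    proof (rule sde_expectation_le[OF sol pos(1,2)])
      show "t > 0" using t pos by simp
      show "continuous_on UNIV h" unfolding h_def by (intro continuous_intros)
      fix v assume v: "sg\<^sup>2 * (exp (- 2 * lam) * (1 - exp (- 2 * lam * t)) / (2 * lam)) \<le> v" "v \<le> sg\<^sup>2 / (2 * lam)"
      have "v0 \<le> sg\<^sup>2 * (exp (- 2 * lam) * (1 - exp (- 2 * lam * t)) / (2 * lam))"
        unfolding v0_def using pos t by (intro mult_left_mono divide_right_mono) auto
      then have vv: "v0 \<le> v" "v > 0" using v v0 by auto
      interpret N: prob_space "isotropic_gaussian v :: 'a measure" by (rule prob_space_isotropic_gaussian[OF vv(2)])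
      have hm [measurable]: "h \<in> borel_measurable borel" unfolding h_def by measurable
      define H where "H x = (\<integral>\<^sup>+y. ennreal (h (x + y)) \<partial>isotropic_gaussian v)" for x
      define z where "z x = exp (- lam * t) *\<^sub>R x + drift_mean lam m t" for x
      have Hm: "H \<in> borel_measurable borel"
        unfolding H_def using vv(2) by (intro measurable_nn_integral_isotropic_gaussian) auto
      have [measurable]: "(\<lambda>x. H (z x)) \<in> borel_measurable borel"
        unfolding z_def by (intro measurable_compose[OF _ Hm]) simp
      have [measurable]: "(\<lambda>y. indicator (cball (0::'a) 1) (x + y) :: ennreal) \<in> borel_measurable borel" for x
        by (rule measurable_compose[of "(+) x" borel borel]) (auto intro!: borel_measurable_indicator)
      have H1: "H x + (\<integral>\<^sup>+y. indicator (cball 0 1) (x + y) \<partial>isotropic_gaussian v) \<le> 1" for x :: 'a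
      proof -
        have "H x + (\<integral>\<^sup>+y. indicator (cball 0 1) (x + y) \<partial>isotropic_gaussian v)
          = (\<integral>\<^sup>+y. ennreal (h (x + y)) + indicator (cball 0 1) (x + y) \<partial>isotropic_gaussian v)"
          unfolding H_def by (rule nn_integral_add[symmetric]) auto
        also have "\<dots> \<le> (\<integral>\<^sup>+(y::'a). 1 \<partial>isotropic_gaussian v)"
          by (intro nn_integral_mono) (auto simp: h_def indicator_def)
        also have "\<dots> = 1" using N.emeasure_space_1 by simp
        finally show ?thesis .
      qed
      have "H (z x) + ennreal \<kappa> * indicator (cball 0 K) x \<le> 1" for x
      proof (cases "x \<in> cball 0 K")
        case True
        have "norm (exp (- lam * t) *\<^sub>R x) \<le> norm x"
          using pos t by (simp add: mult_left_le_one_le)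
        then have "norm (z x) \<le> K + S"
          unfolding z_def using True c by (intro norm_triangle_le) auto
        then have "H (z x) + ennreal \<kappa> \<le> H (z x) + (\<integral>\<^sup>+y. indicator (cball 0 1) (z x + y) \<partial>isotropic_gaussian v)"
          using \<kappa>(2)[OF vv(1) v(2)] by (intro add_left_mono) auto
        also have "\<dots> \<le> 1" by (rule H1)
        finally show ?thesis using True by simp
      next
        case False
        have "H (z x) \<le> 1" using H1[of "z x"] by (rule order_trans[rotated]) simp
        with False show ?thesis by simp
      qed
      then have "(\<integral>\<^sup>+x. H (z x) + ennreal \<kappa> * indicator (cball 0 K) x \<partial>\<mu>) \<le> (\<integral>\<^sup>+x. 1 \<partial>\<mu>)"
        by (intro nn_integral_mono)
      moreover have "(\<integral>\<^sup>+x. H (z x) + ennreal \<kappa> * indicator (cball 0 K) x \<partial>\<mu>)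
          = (\<integral>\<^sup>+x. H (z x) \<partial>\<mu>) + ennreal \<kappa> * emeasure \<mu> (cball 0 K)"
      proof -
        have K: "cball 0 K \<in> sets \<mu>" using \<mu>(2) by simp
        have 1: "(\<lambda>x. H (z x)) \<in> borel_measurable \<mu>" by measurable
        have 2: "(\<lambda>x. ennreal \<kappa> * indicator (cball 0 K) x) \<in> borel_measurable \<mu>"
          using K by measurable
        show ?thesis by (simp only: nn_integral_add[OF 1 2] nn_integral_cmult_indicator[OF K])
      qed
      ultimately have "(\<integral>\<^sup>+x. H (z x) \<partial>\<mu>) + ennreal \<kappa> * emeasure \<mu> (cball 0 K) \<le> 1"
        using \<mu>.emeasure_space_1 by simp
      moreover have "ennreal (\<kappa> / 2) \<le> ennreal \<kappa> * emeasure \<mu> (cball 0 K)"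
        using \<mu>(3) \<kappa>(1) by (simp add: \<mu>.emeasure_eq_measure ennreal_mult[symmetric])
      ultimately have "(\<integral>\<^sup>+x. H (z x) \<partial>\<mu>) + ennreal (\<kappa> / 2) \<le> 1"
        by (meson add_left_mono order_trans)
      then have "(\<integral>\<^sup>+x. H (z x) \<partial>\<mu>) \<le> 1 - ennreal (\<kappa> / 2)"
        by (simp add: ennreal_le_minus_iff add.commute)
      then show "(\<integral>\<^sup>+x. \<integral>\<^sup>+y. ennreal (h (exp (- lam * t) *\<^sub>R x + drift_mean lam m t + y)) \<partial>isotropic_gaussian v \<partial>\<mu>) \<le> 1 - ennreal (\<kappa> / 2)"
        by (simp add: H_def z_def)
    qed
    moreover have "emeasure (law P (X t)) (- cball 0 2) \<le> (\<integral>\<^sup>+x. ennreal (h x) \<partial>law P (X t))"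
    proof -
      have "emeasure (law P (X t)) (- cball 0 2) = (\<integral>\<^sup>+x. indicator (- cball 0 2) x \<partial>law P (X t))"
        by (rule nn_integral_indicator[symmetric]) (auto intro: borel_comp)
      also have "\<dots> \<le> (\<integral>\<^sup>+x. ennreal (h x) \<partial>law P (X t))"
        by (intro nn_integral_mono) (auto simp: h_def indicator_def)
      finally show ?thesis .
    qed
    ultimately have "emeasure (law P (X t)) (- cball 0 2) \<le> 1 - ennreal (\<kappa> / 2)" by (rule order_trans[rotated])
    then have "ennreal (measure (law P (X t)) (- cball 0 2)) \<le> ennreal (1 - \<kappa> / 2)"
      using \<kappa>(1) by (simp add: L.emeasure_eq_measure ennreal_minus[symmetric])
    moreover have "measure (law P (X t)) (- cball 0 2) = 1 - measure (law P (X t)) (cball 0 2)"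
      using L.prob_compl[of "cball 0 2"] by (simp add: Compl_eq_Diff_UNIV)
    ultimately show "min 1 (\<kappa> / 2) \<le> measure (law P (X t)) (cball 0 2)"
      by (cases "\<kappa> / 2 \<le> 1") (auto simp: ennreal_neg)
  qed
qed

subsection \<open>Uniform bounds for consensus schemes\<close>

text \<open>The region taken is the ball of radius \<open>2 * Q\<close>, of mass at least
  \<open>1 / 2\<close> by Markov, and the gap is 0. Nothing is gained from \<alpha>, but the bound
  holds for every law with first moment at most \<open>Q\<close>, the initial one included.\<close>

lemma norm_consensus_point_le_crude:
  fixes f :: "'a::euclidean_space \<Rightarrow> real"
  assumes \<rho>: "prob_space \<rho>" "sets \<rho> = sets borel"
    and f: "continuous_on UNIV f" "\<And>x. fmin \<le> f x"
    and upper: "\<And>x. f x - fmin \<le> c\<^sub>u * ((norm x)\<^sup>2 + 1)"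
    and lower: "\<And>x. M \<le> norm x \<Longrightarrow> c\<^sub>l * (norm x)\<^sup>2 \<le> f x - fmin"
    and pos: "c\<^sub>l > 0" "c\<^sub>u > 0" "M > 0" "Q > 0" "\<alpha> \<ge> 0"
    and int: "integrable \<rho> norm" "(\<integral>x. norm x \<partial>\<rho>) \<le> Q"
  shows "norm (consensus_point \<alpha> f \<rho>) \<le> max M (sqrt (c\<^sub>u * ((2 * Q)\<^sup>2 + 1) / c\<^sub>l)) + 2 * Q"
proof -
  let ?R = "max M (sqrt (c\<^sub>u * ((2 * Q)\<^sup>2 + 1) / c\<^sub>l))"
  have "c\<^sub>u * ((2 * Q)\<^sup>2 + 1) = c\<^sub>l * (sqrt (c\<^sub>u * ((2 * Q)\<^sup>2 + 1) / c\<^sub>l))\<^sup>2"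
    using pos by simp
  also have "\<dots> \<le> c\<^sub>l * ?R\<^sup>2"
    using pos by (intro mult_left_mono power_mono) auto
  finally have R: "c\<^sub>u * ((2 * Q)\<^sup>2 + 1) + 0 \<le> c\<^sub>l * ?R\<^sup>2" by simp
  have "norm (consensus_point \<alpha> f \<rho>) \<le> ?R + exp (- \<alpha> * 0) * (\<integral>x. norm x \<partial>\<rho>) / (1 / 2)"
  proof (rule norm_consensus_point_le[OF \<rho> f _ _ _ int(1) _ half_mass_cball[OF \<rho> int pos(4)] _ _ R])
    show "f x - fmin \<le> c\<^sub>u * ((2 * Q)\<^sup>2 + 1)" if "x \<in> cball 0 (2 * Q)" for x
    proof -
      have "(norm x)\<^sup>2 \<le> (2 * Q)\<^sup>2" using that by (intro power_mono) auto
      then have "c\<^sub>u * ((norm x)\<^sup>2 + 1) \<le> c\<^sub>u * ((2 * Q)\<^sup>2 + 1)" using pos by simp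
      then show ?thesis using upper[of x] by linarith
    qed
  qed (use pos lower in auto)
  then show ?thesis using int(2) by simp
qed

text \<open>Here \<open>\<tau> t\<close> is the time whose law enters the drift at time
  \<open>t\<close>, which covers both schemes. By its trichotomy a law from a time strictly between
  0 and \<open>h\<close> is used only at that very time; an outdated law is either the initial one
  or one on which the noise has acted for at least \<open>h\<close>.\<close>

lemma consensus_scheme_bounded:
  fixes f :: "'a::euclidean_space \<Rightarrow> real" and \<rho>0 :: "'a measure"
  assumes f: "continuous_on UNIV f" "\<And>x. fmin \<le> f x"
    and pos: "c\<^sub>l > 0" "c\<^sub>u > 0" "M > 0"
    and upper: "\<And>x. f x - fmin \<le> c\<^sub>u * ((norm x)\<^sup>2 + 1)"
    and lower: "\<And>x. M \<le> norm x \<Longrightarrow> c\<^sub>l * (norm x)\<^sup>2 \<le> f x - fmin"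
    and lam: "lam > 0" and sg: "sg > 0" and h: "h > 0"
    and \<tau>: "\<And>r. 0 \<le> r \<Longrightarrow> \<tau> r = r \<or> \<tau> r = 0 \<or> h \<le> \<tau> r \<and> \<tau> r \<le> r"
    and p: "1 \<le> p" and \<rho>0: "\<rho>0 \<in> prob_measures_finite_moment p"
  shows "\<exists>\<alpha>0>0. \<exists>S>0. \<forall>\<alpha>\<ge>\<alpha>0. \<forall>(P :: 'w measure) F B X.
    additive_noise_SDE_solution P F B
      (\<lambda>t x. - lam *\<^sub>R (x - consensus_point \<alpha> f (law P (X (\<tau> t))))) sg \<rho>0 X \<longrightarrow>
    (\<forall>t\<ge>0. (\<forall>q\<le>p. abs_moment q (law P (X t)) \<le> ennreal S) \<and>
            norm (consensus_point \<alpha> f (law P (X t))) \<le> S)"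
proof -
  have \<rho>: "prob_space \<rho>0" "sets \<rho>0 = sets borel" and fin: "abs_moment p \<rho>0 < \<infinity>"
    using \<rho>0 by (auto simp: prob_measures_finite_moment_def)
  define M\<^sub>0 where "M\<^sub>0 = enn2real (abs_moment p \<rho>0)"
  have M\<^sub>0: "abs_moment p \<rho>0 \<le> ennreal M\<^sub>0" "M\<^sub>0 \<ge> 0"
    using fin by (auto simp: M\<^sub>0_def)
  define crude where "crude Q = max M (sqrt (c\<^sub>u * ((2 * Q)\<^sup>2 + 1) / c\<^sub>l)) + 2 * Q" for Q
  \<comment> \<open>On \<open>cball 0 2\<close> the excess of \<open>f\<close> over
    \<open>fmin\<close> is at most \<open>c\<^sub>u * (2\<^sup>2 + 1)\<close>, hence the 5; the
    added 1 is the gap that produces the factor \<open>exp (- \<alpha>)\<close>.\<close>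
  define R1 where "R1 = max M (sqrt ((5 * c\<^sub>u + 1) / c\<^sub>l))"
  define R where "R = max (crude (1 + M\<^sub>0)) (R1 + 1)"
  define S where "S = R + 1"
  define Q where "Q = 3 ^ p * (M\<^sub>0 + S ^ p + fact p * (2 * exp (sg\<^sup>2 / (2 * lam) / 2)) ^ DIM('a))"
  define A where "A = crude (1 + Q)"
  \<comment> \<open>The excess \<open>lam * T * A\<close> is at most \<open>1 / 2\<close>, half the
    margin between \<open>R\<close> and \<open>S\<close>; and \<open>T \<le> h\<close> places every
    positive outdated time beyond \<open>T\<close>.\<close>
  define T where "T = min h (1 / (2 * lam * A))"
  have R1: "R1 > 0" "M \<le> R1" using pos by (auto simp: R1_def)
  have R: "R > 0" "crude (1 + M\<^sub>0) \<le> R" "R1 + 1 \<le> R" using R1 by (auto simp: R_def)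
  have "S > 0" using R by (simp add: S_def)
  have "Q \<ge> 0" using \<open>S > 0\<close> M\<^sub>0(2) by (simp add: Q_def)
  have "M \<le> A" "A > 0" using pos \<open>Q \<ge> 0\<close> by (auto simp: A_def crude_def)
  have T: "T > 0" "T \<le> h" using h lam \<open>A > 0\<close> by (auto simp: T_def)
  have "lam * T * A \<le> lam * (1 / (2 * lam * A)) * A"
    using lam \<open>A > 0\<close> by (intro mult_right_mono mult_left_mono) (auto simp: T_def)
  also have "\<dots> = 1 / 2" using lam \<open>A > 0\<close> by simp
  finally have gap: "R + lam * T * A < S" by (simp add: S_def)
  have "1 / 2 \<le> measure \<rho>0 (cball 0 (2 * (1 + M\<^sub>0)))"
    using half_mass_cball[OF \<rho> first_moment_le[OF \<rho> M\<^sub>0 p]] M\<^sub>0(2) by simp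
  then obtain \<eta> where \<eta>: "\<eta> > 0"
    "\<And>(P :: 'w measure) F B m X t. additive_noise_SDE_solution P F B (\<lambda>t x. - lam *\<^sub>R (x - m t)) sg \<rho>0 X \<Longrightarrow>
       t \<ge> T \<Longrightarrow> norm (drift_mean lam m t) \<le> S \<Longrightarrow> \<eta> \<le> measure (law P (X t)) (cball 0 2)"
    using sde_ball_mass[OF lam sg T(1) \<rho>] by metis
  \<comment> \<open>Since \<open>\<alpha> \<le> exp \<alpha>\<close>, this threshold makes
    \<open>exp (- \<alpha>) * (1 + Q) / \<eta>\<close> at most 1. It comes last because
    \<open>\<eta>\<close> depends on \<open>T\<close> and \<open>S\<close>.\<close>
  define \<alpha>0 where "\<alpha>0 = max 1 ((1 + Q) / \<eta>)"
  define S' where "S' = R + A + (1 + Q)"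
  have "(\<forall>q\<le>p. abs_moment q (law P (X t)) \<le> ennreal S') \<and> norm (consensus_point \<alpha> f (law P (X t))) \<le> S'"
    if "\<alpha> \<ge> \<alpha>0" and sol: "additive_noise_SDE_solution P F B
        (\<lambda>t x. - lam *\<^sub>R (x - consensus_point \<alpha> f (law P (X (\<tau> t))))) sg \<rho>0 X" and "t \<ge> 0"
    for \<alpha> t :: real and P :: "'w measure" and F B X
  proof -
    have \<alpha>: "\<alpha> \<ge> 1" "(1 + Q) / \<eta> \<le> \<alpha>" using \<open>\<alpha> \<ge> \<alpha>0\<close> by (auto simp: \<alpha>0_def)
    define m where "m r = consensus_point \<alpha> f (law P (X (\<tau> r)))" for r
    let ?c = "drift_mean lam m"
    let ?a = "\<lambda>t. norm (consensus_point \<alpha> f (law P (X t)))"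
    have sol: "additive_noise_SDE_solution P F B (\<lambda>t x. - lam *\<^sub>R (x - m t)) sg \<rho>0 X"
      using sol by (simp add: m_def)
    have law: "prob_space (law P (X t))" "sets (law P (X t)) = sets borel" if "t \<ge> 0" for t
    proof -
      have "prob_space P"
        using sol by (simp add: additive_noise_SDE_solution_def filtered_prob_space_def)
      then show "prob_space (law P (X t))"
        by (rule prob_space.prob_space_distr) (rule sde_measurable(2)[OF sol that])
    qed simp
    have crude: "norm (consensus_point \<alpha> f \<rho>) \<le> crude (1 + K)"
      if "prob_space \<rho>" "sets \<rho> = sets borel" "abs_moment p \<rho> \<le> ennreal K" "K \<ge> 0" for \<rho> :: "'a measure" and K
      unfolding crude_def using \<alpha> that(4)
      by (intro norm_consensus_point_le_crude[OF that(1,2) f upper lower pos] first_moment_le[OF that p]) auto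
    have mom: "abs_moment p (law P (X t)) \<le> ennreal Q" if "t \<ge> 0" "norm (?c t) \<le> S" for t
      unfolding Q_def by (rule sde_moment_le[OF sol lam sg that(1) \<rho> M\<^sub>0 that(2)])
    have aA: "?a t \<le> A" if "t \<ge> 0" "norm (?c t) \<le> S" for t
      unfolding A_def by (rule crude[OF law[OF that(1)] mom[OF that] \<open>Q \<ge> 0\<close>])
    have a0: "?a 0 \<le> R"
    proof -
      have "law P (X 0) = \<rho>0" using sol by (simp add: additive_noise_SDE_solution_def)
      then show ?thesis using crude[OF \<rho> M\<^sub>0] R(2) by simp
    qed
    have aR: "?a t \<le> R" if "t \<ge> T" "norm (?c t) \<le> S" for t
    proof -
      have t: "t \<ge> 0" using that T by simp
      note fm = first_moment_le[OF law[OF t] mom[OF t that(2)] \<open>Q \<ge> 0\<close> p]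
      have "5 * c\<^sub>u + 1 = c\<^sub>l * (sqrt ((5 * c\<^sub>u + 1) / c\<^sub>l))\<^sup>2" using pos by simp
      also have "\<dots> \<le> c\<^sub>l * R1\<^sup>2"
        unfolding R1_def using pos by (intro mult_left_mono power_mono) auto
      finally have R1sq: "5 * c\<^sub>u + 1 \<le> c\<^sub>l * R1\<^sup>2" .
      have "?a t \<le> R1 + exp (- \<alpha> * 1) * (\<integral>x. norm x \<partial>law P (X t)) / \<eta>"
      proof (rule norm_consensus_point_le[OF law[OF t] f _ _ _ fm(1) _ \<eta>(2)[OF sol that] \<eta>(1) _ R1sq])
        show "f x - fmin \<le> 5 * c\<^sub>u" if "x \<in> cball 0 2" for x
        proof -
          have "(norm x)\<^sup>2 \<le> 2\<^sup>2" using that by (intro power_mono) auto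
          then have "c\<^sub>u * ((norm x)\<^sup>2 + 1) \<le> c\<^sub>u * 5" using pos by (intro mult_left_mono) auto
          then show ?thesis using upper[of x] by simp
        qed
      qed (use pos lower R1 \<alpha> in auto)
      also have "exp (- \<alpha> * 1) * (\<integral>x. norm x \<partial>law P (X t)) / \<eta> \<le> 1"
      proof -
        have "exp (- \<alpha> * 1) * (\<integral>x. norm x \<partial>law P (X t)) \<le> exp (- \<alpha> * 1) * (\<alpha> * \<eta>)"
          using fm(2) \<alpha>(2) \<eta>(1) by (intro mult_left_mono) (auto simp: field_simps)
        also have "\<alpha> \<le> exp \<alpha>" using exp_ge_add_one_self[of \<alpha>] by linarith
        then have "exp (- \<alpha> * 1) * (\<alpha> * \<eta>) \<le> exp (- \<alpha> * 1) * (exp \<alpha> * \<eta>)"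
          using \<eta>(1) by simp
        also have "\<dots> = \<eta>" by (simp add: exp_minus)
        finally show ?thesis using \<eta>(1) by simp
      qed
      finally show ?thesis using R(3) by simp
    qed
    \<comment> \<open>Early laws seen without delay get the crude bound \<open>A\<close>; the
      initial law and all laws from time \<open>T\<close> on get \<open>R\<close>.\<close>
    have bd: "norm (m r) \<le> R + (if r < T then A else 0)"
      if r: "0 \<le> r" and c: "\<And>u. 0 \<le> u \<Longrightarrow> u \<le> r \<Longrightarrow> norm (?c u) \<le> S" for r
    proof -
      consider "\<tau> r = 0" | "T \<le> \<tau> r" "\<tau> r \<le> r" | "\<tau> r = r" "r < T"
        using \<tau>[OF r] T by force
      then show ?thesis
      proof cases
        case 1
        then show ?thesis using a0 \<open>A > 0\<close> by (simp add: m_def)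
      next
        case 2
        then have "?a (\<tau> r) \<le> R" using T by (intro aR c) auto
        then show ?thesis using \<open>A > 0\<close> by (simp add: m_def)
      next
        case 3
        have "?a r \<le> A" using r by (intro aA c) auto
        then show ?thesis using 3 R(1) by (simp add: m_def)
      qed
    qed
    have c: "norm (?c t) \<le> S"
      by (rule drift_mean_bootstrap[OF lam T(1) _ _ gap _ bd \<open>t \<ge> 0\<close>])
        (use R(1) \<open>A > 0\<close> sde_drift_integrable[OF sol lam] in auto)
    have "ennreal (1 + Q) \<le> ennreal S'" using R(1) \<open>A > 0\<close> by (intro ennreal_leI) (simp add: S'_def)
    then have "abs_moment q (law P (X t)) \<le> ennreal S'" if "q \<le> p" for q
      using abs_moment_mono_le[OF law[OF \<open>t \<ge> 0\<close>] mom[OF \<open>t \<ge> 0\<close> c] \<open>Q \<ge> 0\<close> that] by (rule order_trans[rotated])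
    moreover have "?a t \<le> S'" using aA[OF \<open>t \<ge> 0\<close> c] R(1) \<open>Q \<ge> 0\<close> by (simp add: S'_def)
    ultimately show ?thesis by blast
  qed
  moreover have "\<alpha>0 > 0" "S' > 0" using R(1) \<open>A > 0\<close> \<open>Q \<ge> 0\<close> by (auto simp: \<alpha>0_def S'_def)
  ultimately show ?thesis by blast
qed

section \<open>Application to the two schemes\<close>

lemma grid_time_cases:
  assumes "\<Delta>t > 0" "0 \<le> r"
  shows "grid_time \<Delta>t r = 0 \<or> \<Delta>t \<le> grid_time \<Delta>t r \<and> grid_time \<Delta>t r \<le> r"
proof -
  define k where "k = \<lfloor>r / \<Delta>t\<rfloor>"
  have "0 \<le> k" using assms by (simp add: k_def)
  have "of_int k * \<Delta>t \<le> r / \<Delta>t * \<Delta>t"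
    unfolding k_def using assms by (intro mult_right_mono of_int_floor_le) auto
  also have "\<dots> = r" using assms by simp
  finally have le: "of_int k * \<Delta>t \<le> r" .
  have "1 * \<Delta>t \<le> of_int k * \<Delta>t" if "k \<noteq> 0"
    using that \<open>0 \<le> k\<close> assms by (intro mult_right_mono) linarith+
  with le show ?thesis
    unfolding grid_time_def k_def[symmetric] by (cases "k = 0") simp_all
qed

theorem theorem3p9:
  fixes f :: "'a::euclidean_space \<Rightarrow> real"
    and xstar :: 'a
    and fmin L\<^sub>f c\<^sub>l c\<^sub>u M lam \<delta> s \<Delta>t :: real
    and p :: nat
    and \<rho>0 \<mu>0 :: "'a measure"
  assumes "continuous_on UNIV f"
    and "f xstar = fmin" and "\<And>x. fmin \<le> f x" and "\<And>x. f x = fmin \<Longrightarrow> x = xstar"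
    and "L\<^sub>f > 0"
    and "\<And>x y. \<bar>f x - f y\<bar> \<le> L\<^sub>f * (1 + norm x + norm y) * norm (x - y)"
    and "c\<^sub>l > 0" and "c\<^sub>u > 0" and "M > 0"
    and "\<And>x. f x - fmin \<le> c\<^sub>u * ((norm x)\<^sup>2 + 1)"
    and "\<And>x. norm x \<ge> M \<Longrightarrow> c\<^sub>l * (norm x)\<^sup>2 \<le> f x - fmin"
    and "lam > 0" and "\<delta> > 0" and "s > 0" and "\<Delta>t > 0"
    and "p \<ge> 2"
    and "\<rho>0 \<in> prob_measures_finite_moment p" and "\<mu>0 \<in> prob_measures_finite_moment p"
  shows "\<exists>\<alpha>0>0. \<exists>S>0. \<forall>\<alpha>\<ge>\<alpha>0.
    (\<forall>(P :: 'w measure) F B X. delta_CBO_solution P F B f lam \<delta> \<alpha> \<rho>0 X \<longrightarrow>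
       (\<forall>t\<ge>0. (\<forall>q\<le>p. abs_moment q (law P (X t)) \<le> ennreal S) \<and>
               norm (consensus_point \<alpha> f (law P (X t))) \<le> S)) \<and>
    (\<forall>(P :: 'v measure) F B Y. consensus_freezing_solution P F B f lam \<delta> s \<Delta>t \<alpha> \<mu>0 Y \<longrightarrow>
       (\<forall>t\<ge>0. (\<forall>q\<le>p. abs_moment q (law P (Y t)) \<le> ennreal S) \<and>
               norm (consensus_point \<alpha> f (law P (Y t))) \<le> S))"
proof -
  have p: "1 \<le> p" using \<open>p \<ge> 2\<close> by simp
  have pos: "(1::real) > 0" "s * lam > 0" "sqrt s * \<delta> > 0" using assms(12-14) by auto
  \<comment> \<open>Without delay the trichotomy is trivial, so the value 1 for \<open>h\<close> is
    arbitrary.\<close>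
  have \<tau>1: "r = r \<or> r = 0 \<or> 1 \<le> r \<and> r \<le> r" if "0 \<le> r" for r :: real by simp
  have \<tau>2: "grid_time \<Delta>t r = r \<or> grid_time \<Delta>t r = 0 \<or> \<Delta>t \<le> grid_time \<Delta>t r \<and> grid_time \<Delta>t r \<le> r"
    if "0 \<le> r" for r
    using grid_time_cases[OF \<open>\<Delta>t > 0\<close> that] by blast
  have "\<exists>\<alpha>0>0. \<exists>S>0. \<forall>\<alpha>\<ge>\<alpha>0. \<forall>(P :: 'w measure) F B X. delta_CBO_solution P F B f lam \<delta> \<alpha> \<rho>0 X \<longrightarrow>
       (\<forall>t\<ge>0. (\<forall>q\<le>p. abs_moment q (law P (X t)) \<le> ennreal S) \<and>
               norm (consensus_point \<alpha> f (law P (X t))) \<le> S)"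
    unfolding delta_CBO_solution_def
    by (rule consensus_scheme_bounded[where fmin = fmin and c\<^sub>l = c\<^sub>l and c\<^sub>u = c\<^sub>u and M = M
          and \<tau> = "\<lambda>r. r" and h = 1];
        fact assms p pos \<tau>1)
  then obtain \<alpha>1 S1 where 1: "\<alpha>1 > 0" "S1 > 0"
    "\<forall>\<alpha>\<ge>\<alpha>1. \<forall>(P :: 'w measure) F B X. delta_CBO_solution P F B f lam \<delta> \<alpha> \<rho>0 X \<longrightarrow>
       (\<forall>t\<ge>0. (\<forall>q\<le>p. abs_moment q (law P (X t)) \<le> ennreal S1) \<and>
               norm (consensus_point \<alpha> f (law P (X t))) \<le> S1)"
    by blast
  \<comment> \<open>The same bound with friction \<open>s * lam\<close> and noise level
    \<open>sqrt s * \<delta>\<close>; a nonzero grid time is at least one step, so the step serves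
    as \<open>h\<close>.\<close>
  have "\<exists>\<alpha>0>0. \<exists>S>0. \<forall>\<alpha>\<ge>\<alpha>0. \<forall>(P :: 'v measure) F B Y. consensus_freezing_solution P F B f lam \<delta> s \<Delta>t \<alpha> \<mu>0 Y \<longrightarrow>
       (\<forall>t\<ge>0. (\<forall>q\<le>p. abs_moment q (law P (Y t)) \<le> ennreal S) \<and>
               norm (consensus_point \<alpha> f (law P (Y t))) \<le> S)"
    unfolding consensus_freezing_solution_def
    by (rule consensus_scheme_bounded[where fmin = fmin and c\<^sub>l = c\<^sub>l and c\<^sub>u = c\<^sub>u and M = M
          and \<tau> = "grid_time \<Delta>t" and h = "\<Delta>t"];
        fact assms p pos \<tau>2)
  then obtain \<alpha>2 S2 where 2: "\<alpha>2 > 0" "S2 > 0"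
    "\<forall>\<alpha>\<ge>\<alpha>2. \<forall>(P :: 'v measure) F B Y. consensus_freezing_solution P F B f lam \<delta> s \<Delta>t \<alpha> \<mu>0 Y \<longrightarrow>
       (\<forall>t\<ge>0. (\<forall>q\<le>p. abs_moment q (law P (Y t)) \<le> ennreal S2) \<and>
               norm (consensus_point \<alpha> f (law P (Y t))) \<le> S2)"
    by blast
  define S where "S = max S1 S2"
  have S: "S1 \<le> S" "S2 \<le> S" "ennreal S1 \<le> ennreal S" "ennreal S2 \<le> ennreal S"
    by (auto simp: S_def intro: ennreal_leI)
  show ?thesis
  proof (intro exI conjI allI impI)
    show "max \<alpha>1 \<alpha>2 > 0" "S > 0" using 1 2 by (auto simp: S_def)
    fix \<alpha> t :: real assume "max \<alpha>1 \<alpha>2 \<le> \<alpha>" and t: "0 \<le> t"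
    then have \<alpha>: "\<alpha>1 \<le> \<alpha>" "\<alpha>2 \<le> \<alpha>" by simp_all
    {
      fix P :: "'w measure" and F B X
      assume "delta_CBO_solution P F B f lam \<delta> \<alpha> \<rho>0 X"
      then have b: "(\<forall>q\<le>p. abs_moment q (law P (X t)) \<le> ennreal S1) \<and>
          norm (consensus_point \<alpha> f (law P (X t))) \<le> S1"
        using 1(3) \<alpha>(1) t by blast
      show "abs_moment q (law P (X t)) \<le> ennreal S" if "q \<le> p" for q
        using b that S(3) order_trans by blast
      show "norm (consensus_point \<alpha> f (law P (X t))) \<le> S"
        using b S(1) by linarith
    next
      fix P :: "'v measure" and F B Y
      assume "consensus_freezing_solution P F B f lam \<delta> s \<Delta>t \<alpha> \<mu>0 Y"
      then have b: "(\<forall>q\<le>p. abs_moment q (law P (Y t)) \<le> ennreal S2) \<and>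
          norm (consensus_point \<alpha> f (law P (Y t))) \<le> S2"
        using 2(3) \<alpha>(2) t by blast
      show "abs_moment q (law P (Y t)) \<le> ennreal S" if "q \<le> p" for q
        using b that S(4) order_trans by blast
      show "norm (consensus_point \<alpha> f (law P (Y t))) \<le> S"
        using b S(2) by linarith
    }
  qed
qed

end
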